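(* Let $P$ be a non-deterministic recursive program with its control-flow graph, let $\mathsf{f}^*\in F$ be a function name of $P$, and let $\phi^*$ be a propositional arithmetic predicate over $V^{\mathsf{f}^*}$. (1) (Soundness) For every measure function $g$ with respect to $\mathsf{f}^*,\phi^*$ and every valuation $\nu\in \mathrm{Val}_{\mathsf{f}^*}$ with $\nu\models\phi^*$, $$\overline{T}(\mathsf{f}^*,\ell_{\mathrm{in}}^{\mathsf{f}^*},\nu)\le g(\mathsf{f}^*,\ell_{\mathrm{in}}^{\mathsf{f}^*},\nu).$$ (2) (Completeness) The worst-case termination-time function $\overline{T}$ is a measure function with respect to $\mathsf{f}^*,\phi^*$.
   Context: **Expressions and predicates.** Linear arithmetic expressions over a set of scalar variables: $\mathfrak{e}::=c\mid x\mid\lfloor \mathfrak{e}/c\rfloor\mid\mathfrak{e}+\mathfrak{e}\mid\mathfrak{e}-\mathfrak{e}\mid c*\mathfrak{e}$ with $c\in\mathbb{Z}$ (divisors nonzero) and $x$ a variable. A valuation maps variables to $\mathbb{Z}$; $\mathfrak{e}(\nu)\in\mathbb Z$ is the evident evaluation. Propositional arithmetic predicates: $\phi::=\mathfrak{e}\le\mathfrak{e}\mid\mathfrak{e}\ge\mathfrak{e}\mid\neg\phi\mid\phi\wedge\phi\mid\phi\vee\phi$, with the usual satisfaction relation $\nu\models\phi$. **Programs.** A program is a finite sequence of function declarations $\mathsf{f}(x_1,\dots,x_k)\{Q\}$ with distinct function names and distinct parameters in each list. Statements: $Q::=\mathbf{skip}\mid x:=\mathfrak{e}\mid \mathsf{g}(\mathfrak{e}_1,\dots,\mathfrak{e}_k)\mid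 \mathbf{if}\ \phi\ \mathbf{then}\ Q\ \mathbf{else}\ Q\ \mathbf{fi}\mid\mathbf{if}\ \star\ \mathbf{then}\ Q\ \mathbf{else}\ Q\ \mathbf{fi}\mid\mathbf{while}\ \phi\ \mathbf{do}\ Q\ \mathbf{od}\mid Q;Q$, where called functions are declared (with matching arity). **Control-flow graph (CFG).** $F$ is the set of function names; $V^{\mathsf f}$ is the set of variables occurring in the body or parameter list of $\mathsf f$; $\mathrm{Val}_{\mathsf f}$ is the set of valuations $V^{\mathsf f}\to\mathbb Z$. Each $\mathsf{f}$ has a finite set $L^{\mathsf f}$ of labels, partitioned into branching labels $L_{\mathrm b}^{\mathsf f}$, assignment labels $L_{\mathrm a}^{\mathsf f}$, call labels $L_{\mathrm c}^{\mathsf f}$ and demonic labels $L_{\mathrm d}^{\mathsf f}$, an initial label $\ell_{\mathrm{in}}^{\mathsf f}$, a terminal label $\ell_{\mathrm{out}}^{\mathsf f}$ and a set $\to_{\mathsf f}$ of triples $(\ell,\alpha,\ell')$. These are those obtained from the body of $\mathsf f$ by the following induction, which gives each statement $Q$ a relation with an initial label $\mathrm{in}(Q)$ and a terminal label $\mathrm{out}(Q)$. - $x:=\mathfrak e$ or $\mathbf{skip}$: a new assignment label $\mathrm{in}$, a new branching label $\mathrm{out}$, and one triple $(\mathrm{in},h,\mathrm{out})$, with $h$ the update $\nu\mapsto\nu[x\mapsto\mathfrak e(\nu)]$, resp. the identity. - Call $\mathsf g(\mathfrak e_1,\dots,\mathfrak e_k)$, with $\mathsf g$ declared with parameters $q_1,\dots,q_k$: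 a new call label $\mathrm{in}$, a new branching label $\mathrm{out}$, and one triple $(\mathrm{in},(\mathsf g,h),\mathrm{out})$, where $h(\nu)\in\mathrm{Val}_{\mathsf g}$ maps $q_j$ to $\mathfrak e_j(\nu)$ and all other variables of $\mathsf g$ to $0$. - $Q_1;Q_2$: disjoint union, identifying $\mathrm{out}(Q_1)$ with $\mathrm{in}(Q_2)$ (the merged label has the type of $\mathrm{in}(Q_2)$); $\mathrm{in}=\mathrm{in}(Q_1)$, $\mathrm{out}=\mathrm{out}(Q_2)$. - $\mathbf{if}\ \phi\ \mathbf{then}\ Q_1\ \mathbf{else}\ Q_2\ \mathbf{fi}$: a new branching label $\mathrm{in}$ and a new branching label $\mathrm{out}$ identified with $\mathrm{out}(Q_1)$ and $\mathrm{out}(Q_2)$; add triples $(\mathrm{in},\phi,\mathrm{in}(Q_1))$ and $(\mathrm{in},\neg\phi,\mathrm{in}(Q_2))$. - $\mathbf{if}\ \star$: the same with a new demonic label $\mathrm{in}$ and both triples carrying $\star$. - $\mathbf{while}\ \phi\ \mathbf{do}\ Q\ \mathbf{od}$: $\mathrm{in}:=\mathrm{out}(Q)$ (branching), a new branching label $\mathrm{out}$; add triples $(\mathrm{out}(Q),\phi,\mathrm{in}(Q))$ and $(\mathrm{out}(Q),\neg\phi,\mathrm{out})$. Thus each non-terminal assignment or call label has exactly one outgoing triple, and each non-terminal branching (resp. demonic) label has exactly two, carrying $\phi,\neg\phi$ (resp. $\star,\star$). **Semantics.** A stack element is a triple $(\mathsf f,\ell,\nu)$ with $\mathsf f\in F$,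 $\ell\in L^{\mathsf f}$, $\nu\in\mathrm{Val}_{\mathsf f}$; it is non-terminal if $\ell\ne\ell_{\mathrm{out}}^{\mathsf f}$. A configuration is a finite word (possibly the empty word $\varepsilon$) of non-terminal stack elements; its first letter is the top of the call stack. Steps are as follows, where any stack element with terminal label that would be produced is deleted: $\varepsilon\to\varepsilon$; and from $(\mathsf f,\ell,\nu)\cdot w'$: - assignment label with triple $(\ell,h,\ell')$: to $(\mathsf f,\ell',h(\nu))\cdot w'$; - call label with triple $(\ell,(\mathsf g,h),\ell')$: to $(\mathsf g,\ell_{\mathrm{in}}^{\mathsf g},h(\nu))\cdot(\mathsf f,\ell',\nu)\cdot w'$; - branching label with triples $(\ell,\phi,\ell_1),(\ell,\neg\phi,\ell_2)$: to $(\mathsf f,\ell_1,\nu)\cdot w'$ if $\nu\models\phi$, and to $(\mathsf f,\ell_2,\nu)\cdot w'$ otherwise; - demonic label with triples $(\ell,\star,\ell_1),(\ell,\star,\ell_2)$: to $(\mathsf f,\ell_1,\nu)\cdot w'$ or $(\mathsf f,\ell_2,\nu)\cdot w'$, as chosen by the scheduler. A scheduler $\pi$ maps each nonempty finite sequence of configurations whose last one has a demonic label on top to one of the two possible successor configurations of that last one (history-dependent choice). A stack element $\mathfrak c$ and a scheduler $\pi$ determine a unique infinite run $\rho(\mathfrak c,\pi)=\{w_j\}_{j\ge0}$ with $w_0=\mathfrak c$ (with $w_0=\varepsilon$ if $\mathfrak c$ is terminal). **Termination time.** $T(\mathfrak c,\pi):=\min\{j\mid w_j=\varepsilon\}$ ($\min\emptyset=\infty$),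 and $\overline T(\mathfrak c):=\sup_\pi T(\mathfrak c,\pi)$ over all schedulers. **Reachability.** A configuration is reachable w.r.t. $\mathsf f^*,\phi^*$ if it appears in $\rho((\mathsf f^*,\ell_{\mathrm{in}}^{\mathsf f^*},\nu),\pi)$ for some scheduler $\pi$ and some $\nu\models\phi^*$. A stack element $\mathfrak c$ is reachable if $\mathfrak c\cdot w'$ is a reachable configuration for some $w'$. For $\ell\in L^{\mathsf f}\setminus\{\ell_{\mathrm{out}}^{\mathsf f}\}$, $D_{\mathsf f,\ell}$ is the set of $\nu\in\mathrm{Val}_{\mathsf f}$ such that $(\mathsf f,\ell,\nu)$ is reachable w.r.t. $\mathsf f^*,\phi^*$. **Measure function** w.r.t. $\mathsf f^*,\phi^*$: a function $g$ from stack elements to $[0,\infty]$ such that for all stack elements $(\mathsf f,\ell,\nu)$ (with $0\cdot\infty=0$): - C1: if $\ell=\ell_{\mathrm{out}}^{\mathsf f}$ then $g(\mathsf f,\ell,\nu)=0$; - C2: if $\ell\in L_{\mathrm a}^{\mathsf f}\setminus\{\ell_{\mathrm{out}}^{\mathsf f}\}$, $\nu\in D_{\mathsf f,\ell}$ and $(\ell,h,\ell')$ is the triple with source $\ell$, then $g(\mathsf f,\ell',h(\nu))+1\le g(\mathsf f,\ell,\nu)$; - C3: if $\ell\in L_{\mathrm c}^{\mathsf f}\setminus\{\ell_{\mathrm{out}}^{\mathsf f}\}$, $\nu\in D_{\mathsf f,\ell}$ and $(\ell,(\mathsf g,h),\ell')$ is the triple with source $\ell$, then $1+g(\mathsf g,\ell_{\mathrm{in}}^{\mathsf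 g},h(\nu))+g(\mathsf f,\ell',\nu)\le g(\mathsf f,\ell,\nu)$; - C4: if $\ell\in L_{\mathrm b}^{\mathsf f}\setminus\{\ell_{\mathrm{out}}^{\mathsf f}\}$, $\nu\in D_{\mathsf f,\ell}$ and $(\ell,\phi,\ell_1),(\ell,\neg\phi,\ell_2)$ are the triples with source $\ell$, then $\mathbf 1_{\nu\models\phi}\,g(\mathsf f,\ell_1,\nu)+\mathbf 1_{\nu\models\neg\phi}\,g(\mathsf f,\ell_2,\nu)+1\le g(\mathsf f,\ell,\nu)$; - C5: if $\ell\in L_{\mathrm d}^{\mathsf f}\setminus\{\ell_{\mathrm{out}}^{\mathsf f}\}$, $\nu\in D_{\mathsf f,\ell}$ and $(\ell,\star,\ell_1),(\ell,\star,\ell_2)$ are the triples with source $\ell$, then $\max\{g(\mathsf f,\ell_1,\nu),g(\mathsf f,\ell_2,\nu)\}+1\le g(\mathsf f,\ell,\nu)$. *)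

theory Defs
  imports "HOL-Library.FuncSet" "HOL-Library.Extended_Nonnegative_Real"
begin

datatype 'v expr =
    Const int
  | Var 'v
  | Floor "'v expr" int
  | Add "'v expr" "'v expr"
  | Sub "'v expr" "'v expr"
  | Scale int "'v expr"

text \<open>Division \<open>div\<close> on \<open>int\<close> rounds towards minus infinity for divisors of either sign, so
  \<open>a div c\<close> is the floor of the rational quotient.\<close>

primrec eval :: "'v expr \<Rightarrow> ('v \<Rightarrow> int) \<Rightarrow> int" where
  "eval (Const c) \<nu> = c"
| "eval (Var x) \<nu> = \<nu> x"
| "eval (Floor e c) \<nu> = eval e \<nu> div c"
| "eval (Add e1 e2) \<nu> = eval e1 \<nu> + eval e2 \<nu>"
| "eval (Sub e1 e2) \<nu> = eval e1 \<nu> - eval e2 \<nu>"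
| "eval (Scale c e) \<nu> = c * eval e \<nu>"

primrec wf_expr :: "'v expr \<Rightarrow> bool" where
  "wf_expr (Const c) \<longleftrightarrow> True"
| "wf_expr (Var x) \<longleftrightarrow> True"
| "wf_expr (Floor e c) \<longleftrightarrow> c \<noteq> 0 \<and> wf_expr e"
| "wf_expr (Add e1 e2) \<longleftrightarrow> wf_expr e1 \<and> wf_expr e2"
| "wf_expr (Sub e1 e2) \<longleftrightarrow> wf_expr e1 \<and> wf_expr e2"
| "wf_expr (Scale c e) \<longleftrightarrow> wf_expr e"

abbreviation expr_vars :: "'v expr \<Rightarrow> 'v set" where
  "expr_vars \<equiv> set_expr"

datatype 'v pred =
    Le "'v expr" "'v expr"
  | Ge "'v expr" "'v expr"
  | Neg "'v pred"
  | Conj "'v pred" "'v pred"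
  | Disj "'v pred" "'v pred"

primrec sat :: "('v \<Rightarrow> int) \<Rightarrow> 'v pred \<Rightarrow> bool" (infix "\<Turnstile>" 50) where
  "\<nu> \<Turnstile> Le e1 e2 \<longleftrightarrow> eval e1 \<nu> \<le> eval e2 \<nu>"
| "\<nu> \<Turnstile> Ge e1 e2 \<longleftrightarrow> eval e1 \<nu> \<ge> eval e2 \<nu>"
| "\<nu> \<Turnstile> Neg \<phi> \<longleftrightarrow> \<not> \<nu> \<Turnstile> \<phi>"
| "\<nu> \<Turnstile> Conj \<phi> \<psi> \<longleftrightarrow> \<nu> \<Turnstile> \<phi> \<and> \<nu> \<Turnstile> \<psi>"
| "\<nu> \<Turnstile> Disj \<phi> \<psi> \<longleftrightarrow> \<nu> \<Turnstile> \<phi> \<or> \<nu> \<Turnstile> \<psi>"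

primrec wf_pred :: "'v pred \<Rightarrow> bool" where
  "wf_pred (Le e1 e2) \<longleftrightarrow> wf_expr e1 \<and> wf_expr e2"
| "wf_pred (Ge e1 e2) \<longleftrightarrow> wf_expr e1 \<and> wf_expr e2"
| "wf_pred (Neg \<phi>) \<longleftrightarrow> wf_pred \<phi>"
| "wf_pred (Conj \<phi> \<psi>) \<longleftrightarrow> wf_pred \<phi> \<and> wf_pred \<psi>"
| "wf_pred (Disj \<phi> \<psi>) \<longleftrightarrow> wf_pred \<phi> \<and> wf_pred \<psi>"

abbreviation pred_vars :: "'v pred \<Rightarrow> 'v set" where
  "pred_vars \<equiv> set_pred"

datatype ('f, 'v) stmt =
    Skip
  | Assign 'v "'v expr"
  | Call 'f "'v expr list"
  | Cond "'v pred" "('f, 'v) stmt" "('f, 'v) stmt"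
  | Choice "('f, 'v) stmt" "('f, 'v) stmt"
  | While "'v pred" "('f, 'v) stmt"
  | Seq "('f, 'v) stmt" "('f, 'v) stmt"

primrec stmt_vars :: "('f, 'v) stmt \<Rightarrow> 'v set" where
  "stmt_vars Skip = {}"
| "stmt_vars (Assign x e) = insert x (expr_vars e)"
| "stmt_vars (Call g es) = (\<Union>e\<in>set es. expr_vars e)"
| "stmt_vars (Cond \<phi> Q1 Q2) = pred_vars \<phi> \<union> stmt_vars Q1 \<union> stmt_vars Q2"
| "stmt_vars (Choice Q1 Q2) = stmt_vars Q1 \<union> stmt_vars Q2"
| "stmt_vars (While \<phi> Q) = pred_vars \<phi> \<union> stmt_vars Q"
| "stmt_vars (Seq Q1 Q2) = stmt_vars Q1 \<union> stmt_vars Q2"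

text \<open>A function declaration is a tuple of function name, parameter list and body.\<close>

type_synonym ('f, 'v) program = "('f \<times> 'v list \<times> ('f, 'v) stmt) list"

definition fnames :: "('f, 'v) program \<Rightarrow> 'f set" where
  "fnames P = fst ` set P"

definition params :: "('f, 'v) program \<Rightarrow> 'f \<Rightarrow> 'v list" where
  "params P f = fst (the (map_of P f))"

definition body :: "('f, 'v) program \<Rightarrow> 'f \<Rightarrow> ('f, 'v) stmt" where
  "body P f = snd (the (map_of P f))"

primrec wf_stmt :: "('f, 'v) program \<Rightarrow> ('f, 'v) stmt \<Rightarrow> bool" where
  "wf_stmt P Skip \<longleftrightarrow> True"
| "wf_stmt P (Assign x e) \<longleftrightarrow> wf_expr e"
| "wf_stmt P (Call g es) \<longleftrightarrow>
     g \<in> fnames P \<and> length es = length (params P g) \<and> (\<forall>e\<in>set es. wf_expr e)"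
| "wf_stmt P (Cond \<phi> Q1 Q2) \<longleftrightarrow> wf_pred \<phi> \<and> wf_stmt P Q1 \<and> wf_stmt P Q2"
| "wf_stmt P (Choice Q1 Q2) \<longleftrightarrow> wf_stmt P Q1 \<and> wf_stmt P Q2"
| "wf_stmt P (While \<phi> Q) \<longleftrightarrow> wf_pred \<phi> \<and> wf_stmt P Q"
| "wf_stmt P (Seq Q1 Q2) \<longleftrightarrow> wf_stmt P Q1 \<and> wf_stmt P Q2"

definition wf_program :: "('f, 'v) program \<Rightarrow> bool" where
  "wf_program P \<longleftrightarrow> distinct (map fst P) \<and>
     (\<forall>f\<in>fnames P. distinct (params P f) \<and> wf_stmt P (body P f))"

definition fvars :: "('f, 'v) program \<Rightarrow> 'f \<Rightarrow> 'v set" where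
  "fvars P f = set (params P f) \<union> stmt_vars (body P f)"

definition vals :: "('f, 'v) program \<Rightarrow> 'f \<Rightarrow> ('v \<Rightarrow> int) set" where
  "vals P f = (fvars P f \<rightarrow>\<^sub>E UNIV)"

datatype ('f, 'v) action =
    Update "('v \<Rightarrow> int) \<Rightarrow> ('v \<Rightarrow> int)"
  | Enter 'f "('v \<Rightarrow> int) \<Rightarrow> ('v \<Rightarrow> int)"
  | Guard "'v pred"
  | Star

record ('l, 'f, 'v) cfg =
  Lb :: "'l set"
  La :: "'l set"
  Lc :: "'l set"
  Ld :: "'l set"
  lin :: 'l
  lout :: 'l
  triples :: "('l \<times> ('f, 'v) action \<times> 'l) set"

definition labels :: "('l, 'f, 'v) cfg \<Rightarrow> 'l set" where
  "labels G = Lb G \<union> La G \<union> Lc G \<union> Ld G"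

definition call_val ::
  "('f, 'v) program \<Rightarrow> 'f \<Rightarrow> 'v expr list \<Rightarrow> ('v \<Rightarrow> int) \<Rightarrow> ('v \<Rightarrow> int)" where
  "call_val P g es \<nu> =
     (\<lambda>x\<in>fvars P g. case map_of (zip (params P g) es) x of Some e \<Rightarrow> eval e \<nu> | None \<Rightarrow> 0)"

text \<open>\<open>stmt_cfg P Q G\<close>: \<open>G\<close> is a control-flow graph of the statement \<open>Q\<close>. Since new labels may be
  any labels not used so far, the graph is determined only up to renaming of labels, whence a
  relation. Subgraphs share exactly the labels that are to be identified and are otherwise disjoint.
  In a sequence, \<open>lout G1\<close> gives up its branching type, so that the merged label keeps only the
  type it has as \<open>lin G2\<close>.\<close>

inductive stmt_cfg ::
  "('f, 'v) program \<Rightarrow> ('f, 'v) stmt \<Rightarrow> ('l, 'f, 'v) cfg \<Rightarrow> bool" for P where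
  skip:
    "i \<noteq> o' \<Longrightarrow>
     stmt_cfg P Skip
       \<lparr>Lb = {o'}, La = {i}, Lc = {}, Ld = {}, lin = i, lout = o',
        triples = {(i, Update (\<lambda>\<nu>. \<nu>), o')}\<rparr>"
| assign:
    "i \<noteq> o' \<Longrightarrow>
     stmt_cfg P (Assign x e)
       \<lparr>Lb = {o'}, La = {i}, Lc = {}, Ld = {}, lin = i, lout = o',
        triples = {(i, Update (\<lambda>\<nu>. \<nu>(x := eval e \<nu>)), o')}\<rparr>"
| call:
    "i \<noteq> o' \<Longrightarrow>
     stmt_cfg P (Call g es)
       \<lparr>Lb = {o'}, La = {}, Lc = {i}, Ld = {}, lin = i, lout = o',
        triples = {(i, Enter g (call_val P g es), o')}\<rparr>"
| seq:
    "stmt_cfg P Q1 G1 \<Longrightarrow> stmt_cfg P Q2 G2 \<Longrightarrow>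
     lout G1 = lin G2 \<Longrightarrow> labels G1 \<inter> labels G2 = {lin G2} \<Longrightarrow>
     stmt_cfg P (Seq Q1 Q2)
       \<lparr>Lb = (Lb G1 - {lout G1}) \<union> Lb G2, La = La G1 \<union> La G2,
        Lc = Lc G1 \<union> Lc G2, Ld = Ld G1 \<union> Ld G2, lin = lin G1, lout = lout G2,
        triples = triples G1 \<union> triples G2\<rparr>"
| cond:
    "stmt_cfg P Q1 G1 \<Longrightarrow> stmt_cfg P Q2 G2 \<Longrightarrow>
     lout G1 = o' \<Longrightarrow> lout G2 = o' \<Longrightarrow> labels G1 \<inter> labels G2 = {o'} \<Longrightarrow>
     i \<notin> labels G1 \<union> labels G2 \<Longrightarrow>
     stmt_cfg P (Cond \<phi> Q1 Q2)
       \<lparr>Lb = insert i (Lb G1 \<union> Lb G2), La = La G1 \<union> La G2,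
        Lc = Lc G1 \<union> Lc G2, Ld = Ld G1 \<union> Ld G2, lin = i, lout = o',
        triples = {(i, Guard \<phi>, lin G1), (i, Guard (Neg \<phi>), lin G2)} \<union> triples G1 \<union> triples G2\<rparr>"
| choice:
    "stmt_cfg P Q1 G1 \<Longrightarrow> stmt_cfg P Q2 G2 \<Longrightarrow>
     lout G1 = o' \<Longrightarrow> lout G2 = o' \<Longrightarrow> labels G1 \<inter> labels G2 = {o'} \<Longrightarrow>
     i \<notin> labels G1 \<union> labels G2 \<Longrightarrow>
     stmt_cfg P (Choice Q1 Q2)
       \<lparr>Lb = Lb G1 \<union> Lb G2, La = La G1 \<union> La G2,
        Lc = Lc G1 \<union> Lc G2, Ld = insert i (Ld G1 \<union> Ld G2), lin = i, lout = o',
        triples = {(i, Star, lin G1), (i, Star, lin G2)} \<union> triples G1 \<union> triples G2\<rparr>"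
| while:
    "stmt_cfg P Q G \<Longrightarrow> o' \<notin> labels G \<Longrightarrow>
     stmt_cfg P (While \<phi> Q)
       \<lparr>Lb = insert o' (Lb G), La = La G, Lc = Lc G, Ld = Ld G, lin = lout G, lout = o',
        triples = {(lout G, Guard \<phi>, lin G), (lout G, Guard (Neg \<phi>), o')} \<union> triples G\<rparr>"

definition program_cfg :: "('f, 'v) program \<Rightarrow> ('f \<Rightarrow> ('l, 'f, 'v) cfg) \<Rightarrow> bool" where
  "program_cfg P G \<longleftrightarrow> (\<forall>f\<in>fnames P. stmt_cfg P (body P f) (G f))"

text \<open>Fresh labels never run out: over an infinite label type every program has a control-flow
  graph. The induction builds graphs with a prescribed terminal label \<open>o'\<close> that avoid the labels
  already in use.\<close>

lemma stmt_cfg_lin_lout: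
  "stmt_cfg P Q G \<Longrightarrow>
     finite (labels G) \<and> lin G \<in> labels G \<and> lout G \<in> Lb G \<and> lin G \<noteq> lout G"
proof (induction rule: stmt_cfg.induct)
  case (seq Q1 G1 Q2 G2)
  then have "lout G2 \<in> labels G2" by (simp add: labels_def)
  then have "lin G1 \<noteq> lout G2" using seq.IH seq.hyps(4) by (metis IntI singletonD)
  moreover have "lin G1 \<in> labels G1 - {lout G1}" using seq.IH by blast
  moreover have "finite (labels G1 \<union> labels G2)" using seq.IH by blast
  ultimately show ?case using seq.IH(2) unfolding labels_def by simp blast
next
  case (cond Q1 G1 Q2 G2 o' i \<phi>)
  then have "o' \<in> labels G1" by (simp add: labels_def)
  then have "i \<noteq> o'" using cond.hyps(6) by blast
  then show ?case using cond.IH cond.hyps(3) unfolding labels_def by simp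
next
  case (choice Q1 G1 Q2 G2 o' i)
  then have "o' \<in> labels G1" by (simp add: labels_def)
  then have "i \<noteq> o'" using choice.hyps(6) by blast
  then show ?case using choice.IH choice.hyps(3) unfolding labels_def by simp
next
  case (while Q G o' \<phi>)
  then have "lout G \<noteq> o'" by (auto simp: labels_def)
  then show ?case using while.IH unfolding labels_def by simp
qed (simp_all add: labels_def)

lemma stmt_cfg_witness:
  "stmt_cfg P Q G \<Longrightarrow> lout G = o' \<Longrightarrow> labels G \<subseteq> L \<Longrightarrow> L \<inter> X \<subseteq> {o'} \<Longrightarrow>
  \<exists>G. stmt_cfg P Q G \<and> lout G = o' \<and> labels G \<inter> X \<subseteq> {o'}" by blast

lemma stmt_cfg_exists:
  fixes o' :: 'l
  assumes inf: "infinite (UNIV :: 'l set)" "finite X"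
  shows "\<exists>G :: ('l, 'f, 'v) cfg. stmt_cfg P Q G \<and> lout G = o' \<and> labels G \<inter> X \<subseteq> {o'}"
  using assms(2)
proof (induction Q arbitrary: o' X)
  case Skip
  obtain i where "i \<notin> insert o' X" using inf(1) Skip by (meson ex_new_if_finite finite_insert)
  then show ?case
    by (intro stmt_cfg_witness[OF stmt_cfg.skip[of i o'],
        where L = "{i, o'}"]) (auto simp: labels_def)
next
  case (Assign x e)
  obtain i where "i \<notin> insert o' X" using inf(1) Assign by (meson ex_new_if_finite finite_insert)
  then show ?case
    by (intro stmt_cfg_witness[OF stmt_cfg.assign[of i o'],
        where L = "{i, o'}"]) (auto simp: labels_def)
next
  case (Call g es)
  obtain i where "i \<notin> insert o' X" using inf(1) Call by (meson ex_new_if_finite finite_insert)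
  then show ?case
    by (intro stmt_cfg_witness[OF stmt_cfg.call[of i o'],
        where L = "{i, o'}"]) (auto simp: labels_def)
next
  case (Cond \<phi> Q1 Q2)
  obtain G1 :: "('l, 'f, 'v) cfg" where G1: "stmt_cfg P Q1 G1" "lout G1 = o'"
      "labels G1 \<inter> X \<subseteq> {o'}"
    using Cond.IH(1) Cond.prems by blast
  have f1: "finite (X \<union> labels G1)" using Cond.prems stmt_cfg_lin_lout[OF G1(1)] by simp
  obtain G2 :: "('l, 'f, 'v) cfg" where G2: "stmt_cfg P Q2 G2" "lout G2 = o'"
      "labels G2 \<inter> (X \<union> labels G1) \<subseteq> {o'}"
    using Cond.IH(2)[OF f1] by blast
  have "finite (X \<union> labels G1 \<union> labels G2)" using f1 stmt_cfg_lin_lout[OF G2(1)] by simp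
  then obtain i where i: "i \<notin> X \<union> labels G1 \<union> labels G2" using inf(1) by (meson ex_new_if_finite)
  have "o' \<in> labels G1" "o' \<in> labels G2"
    using stmt_cfg_lin_lout[OF G1(1)] stmt_cfg_lin_lout[OF G2(1)]
    unfolding G1(2) G2(2) by (simp_all add: labels_def)
  then have d: "labels G1 \<inter> labels G2 = {o'}" using G2(3) by blast
  have e: "i \<notin> labels G1 \<union> labels G2" using i by blast
  show ?case
  proof (rule stmt_cfg_witness[OF stmt_cfg.cond[OF G1(1) G2(1) G1(2) G2(2) d e],
        where L = "insert i (labels G1 \<union> labels G2)"], goal_cases)
    case 1
    then show ?case using G2(2) by simp
  next
    case 2
    then show ?case unfolding labels_def by auto
  next
    case 3
    then show ?case using i G1(3) G2(3) d by blast
  qed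
next
  case (Choice Q1 Q2)
  obtain G1 :: "('l, 'f, 'v) cfg" where G1: "stmt_cfg P Q1 G1" "lout G1 = o'"
      "labels G1 \<inter> X \<subseteq> {o'}"
    using Choice.IH(1) Choice.prems by blast
  have f1: "finite (X \<union> labels G1)" using Choice.prems stmt_cfg_lin_lout[OF G1(1)] by simp
  obtain G2 :: "('l, 'f, 'v) cfg" where G2: "stmt_cfg P Q2 G2" "lout G2 = o'"
      "labels G2 \<inter> (X \<union> labels G1) \<subseteq> {o'}"
    using Choice.IH(2)[OF f1] by blast
  have "finite (X \<union> labels G1 \<union> labels G2)" using f1 stmt_cfg_lin_lout[OF G2(1)] by simp
  then obtain i where i: "i \<notin> X \<union> labels G1 \<union> labels G2" using inf(1) by (meson ex_new_if_finite)
  have "o' \<in> labels G1" "o' \<in> labels G2"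
    using stmt_cfg_lin_lout[OF G1(1)] stmt_cfg_lin_lout[OF G2(1)]
    unfolding G1(2) G2(2) by (simp_all add: labels_def)
  then have d: "labels G1 \<inter> labels G2 = {o'}" using G2(3) by blast
  have e: "i \<notin> labels G1 \<union> labels G2" using i by blast
  show ?case
  proof (rule stmt_cfg_witness[OF stmt_cfg.choice[OF G1(1) G2(1) G1(2) G2(2) d e],
        where L = "insert i (labels G1 \<union> labels G2)"], goal_cases)
    case 1
    then show ?case using G2(2) by simp
  next
    case 2
    then show ?case unfolding labels_def by auto
  next
    case 3
    then show ?case using i G1(3) G2(3) d by blast
  qed
next
  case (While \<phi> Q)
  obtain m where m: "m \<notin> insert o' X" using inf(1) While by (meson ex_new_if_finite finite_insert)
  obtain G :: "('l, 'f, 'v) cfg" where G: "stmt_cfg P Q G" "lout G = m"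
      "labels G \<inter> insert o' X \<subseteq> {m}"
    using While.IH[of "insert o' X"] While.prems by blast
  have d: "o' \<notin> labels G" using m G(3) by blast
  show ?case
  proof (rule stmt_cfg_witness[OF stmt_cfg.while[OF G(1) d],
        where L = "insert o' (labels G)"], goal_cases)
    case 1
    then show ?case using G(2) by simp
  next
    case 2
    then show ?case unfolding labels_def by auto
  next
    case 3
    then show ?case using m G(3) by blast
  qed
next
  case (Seq Q1 Q2)
  obtain G2 :: "('l, 'f, 'v) cfg" where G2: "stmt_cfg P Q2 G2" "lout G2 = o'"
      "labels G2 \<inter> X \<subseteq> {o'}"
    using Seq.IH(2) Seq.prems by blast
  have f2: "finite (insert o' X \<union> labels G2)" using Seq.prems stmt_cfg_lin_lout[OF G2(1)] by simp
  obtain G1 :: "('l, 'f, 'v) cfg" where G1: "stmt_cfg P Q1 G1" "lout G1 = lin G2"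
      "labels G1 \<inter> (insert o' X \<union> labels G2) \<subseteq> {lin G2}"
    using Seq.IH(1)[OF f2] by blast
  have l: "lin G2 \<in> labels G1" "lin G2 \<in> labels G2"
    using stmt_cfg_lin_lout[OF G1(1)] stmt_cfg_lin_lout[OF G2(1)]
    unfolding G1(2) by (simp_all add: labels_def)
  then have d: "labels G1 \<inter> labels G2 = {lin G2}" using G1(3) by blast
  show ?case
  proof (rule stmt_cfg_witness[OF stmt_cfg.seq[OF G1(1) G2(1) G1(2) d],
        where L = "labels G1 \<union> labels G2"], goal_cases)
    case 1
    then show ?case using G2(2) by simp
  next
    case 2
    then show ?case unfolding labels_def by auto
  next
    case 3
    then show ?case using l G1(3) G2(3) by blast
  qed
qed

lemma program_cfg_exists:
  assumes "infinite (UNIV :: 'l set)"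
  shows "\<exists>G :: 'f \<Rightarrow> ('l, 'f, 'v) cfg. program_cfg P G"
proof -
  have "\<forall>f. \<exists>G :: ('l, 'f, 'v) cfg. stmt_cfg P (body P f) G"
    using stmt_cfg_exists[OF assms finite.emptyI] by blast
  then show ?thesis
    unfolding program_cfg_def by metis
qed

type_synonym ('f, 'l, 'v) stack_elem = "'f \<times> 'l \<times> ('v \<Rightarrow> int)"

type_synonym ('f, 'l, 'v) config = "('f, 'l, 'v) stack_elem list"

definition stack_elems ::
  "('f, 'v) program \<Rightarrow> ('f \<Rightarrow> ('l, 'f, 'v) cfg) \<Rightarrow> ('f, 'l, 'v) stack_elem set" where
  "stack_elems P G = {(f, l, \<nu>). f \<in> fnames P \<and> l \<in> labels (G f) \<and> \<nu> \<in> vals P f}"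

definition non_terminal :: "('f \<Rightarrow> ('l, 'f, 'v) cfg) \<Rightarrow> ('f, 'l, 'v) stack_elem \<Rightarrow> bool" where
  "non_terminal G = (\<lambda>(f, l, \<nu>). l \<noteq> lout (G f))"

definition configs ::
  "('f, 'v) program \<Rightarrow> ('f \<Rightarrow> ('l, 'f, 'v) cfg) \<Rightarrow> ('f, 'l, 'v) config set" where
  "configs P G = lists {c \<in> stack_elems P G. non_terminal G c}"

definition prune ::
  "('f \<Rightarrow> ('l, 'f, 'v) cfg) \<Rightarrow> ('f, 'l, 'v) stack_elem list \<Rightarrow> ('f, 'l, 'v) config" where
  "prune G = filter (non_terminal G)"

inductive step ::
  "('f \<Rightarrow> ('l, 'f, 'v) cfg) \<Rightarrow> ('f, 'l, 'v) config \<Rightarrow> ('f, 'l, 'v) config \<Rightarrow> bool" for G where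
  empty: "step G [] []"
| assign:
    "l \<in> La (G f) \<Longrightarrow> (l, Update h, l') \<in> triples (G f) \<Longrightarrow>
     step G ((f, l, \<nu>) # w) (prune G [(f, l', h \<nu>)] @ w)"
| call:
    "l \<in> Lc (G f) \<Longrightarrow> (l, Enter g h, l') \<in> triples (G f) \<Longrightarrow>
     step G ((f, l, \<nu>) # w) (prune G [(g, lin (G g), h \<nu>), (f, l', \<nu>)] @ w)"
| branch_true:
    "l \<in> Lb (G f) \<Longrightarrow> (l, Guard \<phi>, l1) \<in> triples (G f) \<Longrightarrow>
     (l, Guard (Neg \<phi>), l2) \<in> triples (G f) \<Longrightarrow> \<nu> \<Turnstile> \<phi> \<Longrightarrow>
     step G ((f, l, \<nu>) # w) (prune G [(f, l1, \<nu>)] @ w)"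
| branch_false:
    "l \<in> Lb (G f) \<Longrightarrow> (l, Guard \<phi>, l1) \<in> triples (G f) \<Longrightarrow>
     (l, Guard (Neg \<phi>), l2) \<in> triples (G f) \<Longrightarrow> \<not> \<nu> \<Turnstile> \<phi> \<Longrightarrow>
     step G ((f, l, \<nu>) # w) (prune G [(f, l2, \<nu>)] @ w)"
| demonic:
    "l \<in> Ld (G f) \<Longrightarrow> (l, Star, l') \<in> triples (G f) \<Longrightarrow>
     step G ((f, l, \<nu>) # w) (prune G [(f, l', \<nu>)] @ w)"

definition demonic_top :: "('f \<Rightarrow> ('l, 'f, 'v) cfg) \<Rightarrow> ('f, 'l, 'v) config \<Rightarrow> bool" where
  "demonic_top G w \<longleftrightarrow> (\<exists>f l \<nu> w'. w = (f, l, \<nu>) # w' \<and> l \<in> Ld (G f))"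

text \<open>The values of a scheduler outside the histories ending in a demonic configuration are
  arbitrary and never used.\<close>

definition scheduler ::
  "('f, 'v) program \<Rightarrow> ('f \<Rightarrow> ('l, 'f, 'v) cfg) \<Rightarrow>
   (('f, 'l, 'v) config list \<Rightarrow> ('f, 'l, 'v) config) \<Rightarrow> bool" where
  "scheduler P G \<pi> \<longleftrightarrow>
     (\<forall>ws\<in>lists (configs P G). ws \<noteq> [] \<and> demonic_top G (last ws) \<longrightarrow> step G (last ws) (\<pi> ws))"

text \<open>\<open>history G c \<pi> n\<close> is the initial segment \<open>[w\<^sub>0, \<dots>, w\<^sub>n]\<close> of the run from \<open>c\<close>.
  A configuration without a demonic top has exactly one successor, so the description below is
  well-defined.\<close>

definition next_config ::
  "('f \<Rightarrow> ('l, 'f, 'v) cfg) \<Rightarrow> (('f, 'l, 'v) config list \<Rightarrow> ('f, 'l, 'v) config) \<Rightarrow>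
   ('f, 'l, 'v) config list \<Rightarrow> ('f, 'l, 'v) config" where
  "next_config G \<pi> ws =
     (if demonic_top G (last ws) then \<pi> ws else (THE w. step G (last ws) w))"

primrec history ::
  "('f \<Rightarrow> ('l, 'f, 'v) cfg) \<Rightarrow> ('f, 'l, 'v) stack_elem \<Rightarrow>
   (('f, 'l, 'v) config list \<Rightarrow> ('f, 'l, 'v) config) \<Rightarrow> nat \<Rightarrow> ('f, 'l, 'v) config list" where
  "history G c \<pi> 0 = [prune G [c]]"
| "history G c \<pi> (Suc n) = history G c \<pi> n @ [next_config G \<pi> (history G c \<pi> n)]"

definition run ::
  "('f \<Rightarrow> ('l, 'f, 'v) cfg) \<Rightarrow> ('f, 'l, 'v) stack_elem \<Rightarrow>
   (('f, 'l, 'v) config list \<Rightarrow> ('f, 'l, 'v) config) \<Rightarrow> nat \<Rightarrow> ('f, 'l, 'v) config" where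
  "run G c \<pi> j = last (history G c \<pi> j)"

text \<open>On \<open>enat\<close> the infimum of a nonempty set is its minimum, and that of the empty set is \<open>\<infinity>\<close>.\<close>

definition term_time ::
  "('f \<Rightarrow> ('l, 'f, 'v) cfg) \<Rightarrow> ('f, 'l, 'v) stack_elem \<Rightarrow>
   (('f, 'l, 'v) config list \<Rightarrow> ('f, 'l, 'v) config) \<Rightarrow> enat" where
  "term_time G c \<pi> = (INF j\<in>{j. run G c \<pi> j = []}. enat j)"

definition worst_time ::
  "('f, 'v) program \<Rightarrow> ('f \<Rightarrow> ('l, 'f, 'v) cfg) \<Rightarrow> ('f, 'l, 'v) stack_elem \<Rightarrow> enat" where
  "worst_time P G c = (SUP \<pi>\<in>{\<pi>. scheduler P G \<pi>}. term_time G c \<pi>)"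

definition reachable_config ::
  "('f, 'v) program \<Rightarrow> ('f \<Rightarrow> ('l, 'f, 'v) cfg) \<Rightarrow> 'f \<Rightarrow> 'v pred \<Rightarrow>
   ('f, 'l, 'v) config \<Rightarrow> bool" where
  "reachable_config P G fstar \<phi>star w \<longleftrightarrow>
     (\<exists>\<pi> \<nu> j. scheduler P G \<pi> \<and> \<nu> \<in> vals P fstar \<and> \<nu> \<Turnstile> \<phi>star \<and>
        run G (fstar, lin (G fstar), \<nu>) \<pi> j = w)"

definition reachable ::
  "('f, 'v) program \<Rightarrow> ('f \<Rightarrow> ('l, 'f, 'v) cfg) \<Rightarrow> 'f \<Rightarrow> 'v pred \<Rightarrow>
   ('f, 'l, 'v) stack_elem \<Rightarrow> bool" where
  "reachable P G fstar \<phi>star c \<longleftrightarrow> (\<exists>w'. reachable_config P G fstar \<phi>star (c # w'))"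

definition reach_vals ::
  "('f, 'v) program \<Rightarrow> ('f \<Rightarrow> ('l, 'f, 'v) cfg) \<Rightarrow> 'f \<Rightarrow> 'v pred \<Rightarrow>
   'f \<Rightarrow> 'l \<Rightarrow> ('v \<Rightarrow> int) set" where
  "reach_vals P G fstar \<phi>star f l = {\<nu> \<in> vals P f. reachable P G fstar \<phi>star (f, l, \<nu>)}"

text \<open>The universally quantified triples with source \<open>l\<close> are unique in a graph given by \<open>stmt_cfg\<close>.
  Multiplication on \<open>ennreal\<close> satisfies \<open>0 * \<infinity> = 0\<close>.\<close>

definition measure_function ::
  "('f, 'v) program \<Rightarrow> ('f \<Rightarrow> ('l, 'f, 'v) cfg) \<Rightarrow> 'f \<Rightarrow> 'v pred \<Rightarrow>
   (('f, 'l, 'v) stack_elem \<Rightarrow> ennreal) \<Rightarrow> bool" where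
  "measure_function P G fstar \<phi>star g \<longleftrightarrow>
     (\<forall>(f, l, \<nu>)\<in>stack_elems P G.
        (l = lout (G f) \<longrightarrow> g (f, l, \<nu>) = 0) \<and>
        (l \<in> La (G f) - {lout (G f)} \<and> \<nu> \<in> reach_vals P G fstar \<phi>star f l \<longrightarrow>
           (\<forall>h l'. (l, Update h, l') \<in> triples (G f) \<longrightarrow>
              g (f, l', h \<nu>) + 1 \<le> g (f, l, \<nu>))) \<and>
        (l \<in> Lc (G f) - {lout (G f)} \<and> \<nu> \<in> reach_vals P G fstar \<phi>star f l \<longrightarrow>
           (\<forall>f' h l'. (l, Enter f' h, l') \<in> triples (G f) \<longrightarrow>
              1 + g (f', lin (G f'), h \<nu>) + g (f, l', \<nu>) \<le> g (f, l, \<nu>))) \<and>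
        (l \<in> Lb (G f) - {lout (G f)} \<and> \<nu> \<in> reach_vals P G fstar \<phi>star f l \<longrightarrow>
           (\<forall>\<phi> l1 l2. (l, Guard \<phi>, l1) \<in> triples (G f) \<and>
                      (l, Guard (Neg \<phi>), l2) \<in> triples (G f) \<longrightarrow>
              of_bool (\<nu> \<Turnstile> \<phi>) * g (f, l1, \<nu>) + of_bool (\<nu> \<Turnstile> Neg \<phi>) * g (f, l2, \<nu>) + 1
                \<le> g (f, l, \<nu>))) \<and>
        (l \<in> Ld (G f) - {lout (G f)} \<and> \<nu> \<in> reach_vals P G fstar \<phi>star f l \<longrightarrow>
           (\<forall>l1 l2. {(l, Star, l1), (l, Star, l2)} = {t \<in> triples (G f). fst t = l} \<longrightarrow>
              max (g (f, l1, \<nu>)) (g (f, l2, \<nu>)) + 1 \<le> g (f, l, \<nu>))))"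

end

(* Write R for the steps that leave a nonempty configuration. Both halves rest on the fact that the
   worst-case time from c is at least n iff there is an R-path of length n from c: a run that stays
   nonempty is such a path, and conversely a scheduler with history may simply follow a given path.
   Soundness: the sum of g over the call stack drops by at least 1 along every step of R.
   Completeness: prepending a step lengthens a path by one; for calls, a path of length m from u and
   one of length n from w give one of length m + n from the stack u w, since the first path can
   either be prolonged by n steps or be prolonged until u is popped. *)

theory Submission
  imports Defs
begin

section \<open>Local structure of control-flow graphs: the node at each label\<close>

definition out_edges :: "('l, 'f, 'v) cfg \<Rightarrow> 'l \<Rightarrow> (('f, 'v) action \<times> 'l) set" where
  "out_edges G l = {(a, l'). (l, a, l') \<in> triples G}"

lemma triples_from: "{t \<in> triples G. fst t = l} = Pair l ` out_edges G l"
  unfolding out_edges_def by force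

text \<open>The Booleans tell whether a label is branching, assignment, call or demonic.\<close>

inductive node_ok ::
  "('f, 'v) program \<Rightarrow> 'v set \<Rightarrow> bool \<Rightarrow> bool \<Rightarrow> bool \<Rightarrow> bool \<Rightarrow> (('f, 'v) action \<times> 'l) set \<Rightarrow> bool"
  for P V where
  update: "(\<And>\<nu>. \<nu> \<in> V \<rightarrow>\<^sub>E UNIV \<Longrightarrow> h \<nu> \<in> V \<rightarrow>\<^sub>E UNIV) \<Longrightarrow>
    node_ok P V False True False False {(Update h, l')}"
| enter: "g \<in> fnames P \<Longrightarrow> (\<And>\<nu>. h \<nu> \<in> vals P g) \<Longrightarrow>
    node_ok P V False False True False {(Enter g h, l')}"
| guard: "node_ok P V True False False False {(Guard \<phi>, l1), (Guard (Neg \<phi>), l2)}"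
| star: "node_ok P V False False False True {(Star, l1), (Star, l2)}"

abbreviation label_ok :: "('f, 'v) program \<Rightarrow> 'v set \<Rightarrow> ('l, 'f, 'v) cfg \<Rightarrow> 'l \<Rightarrow> bool" where
  "label_ok P V G l \<equiv> node_ok P V (l \<in> Lb G) (l \<in> La G) (l \<in> Lc G) (l \<in> Ld G) (out_edges G l)"

text \<open>The invariant of the induction over statements. \<open>lout G\<close> is exempt from
  \<open>label_ok\<close>: it has no outgoing triple and is purely branching, so it can later be
  merged with the start of a second statement or become the head of a loop. \<open>V\<close> stays
  the same for all parts of one body.\<close>

definition cfg_ok :: "('f, 'v) program \<Rightarrow> 'v set \<Rightarrow> ('l, 'f, 'v) cfg \<Rightarrow> bool" where
  "cfg_ok P V G \<longleftrightarrow>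
     (\<forall>l a l'. (l, a, l') \<in> triples G \<longrightarrow> l \<in> labels G - {lout G} \<and> l' \<in> labels G) \<and>
     lout G \<in> Lb G \<and> lout G \<notin> La G \<union> Lc G \<union> Ld G \<and> lin G \<in> labels G \<and> lin G \<noteq> lout G \<and>
     (\<forall>l \<in> labels G - {lout G}. label_ok P V G l)"

text \<open>For labels untouched by gluing: \<open>node_ok\<close> looks only at the types of a
  label and its outgoing edges.\<close>

lemma label_ok_mono:
  assumes "label_ok P V G l"
    and "l \<in> Lb H \<longleftrightarrow> l \<in> Lb G" "l \<in> La H \<longleftrightarrow> l \<in> La G"
    and "l \<in> Lc H \<longleftrightarrow> l \<in> Lc G" "l \<in> Ld H \<longleftrightarrow> l \<in> Ld G"
    and "\<And>a l'. (l, a, l') \<in> triples H \<longleftrightarrow> (l, a, l') \<in> triples G"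
  shows "label_ok P V H l"
  using assms unfolding out_edges_def by simp

lemma cfg_okD:
  assumes "cfg_ok P V G"
  shows "(l, a, l') \<in> triples G \<Longrightarrow> l \<in> labels G" "(l, a, l') \<in> triples G \<Longrightarrow> l \<noteq> lout G"
    "(l, a, l') \<in> triples G \<Longrightarrow> l' \<in> labels G"
    "lout G \<in> Lb G" "lout G \<notin> La G" "lout G \<notin> Lc G" "lout G \<notin> Ld G" "lin G \<in> labels G"
    "lin G \<noteq> lout G" "l \<in> labels G \<Longrightarrow> l \<noteq> lout G \<Longrightarrow> label_ok P V G l"
  using assms unfolding cfg_ok_def by blast+

lemma label_sets: "l \<notin> labels G \<Longrightarrow> l \<notin> Lb G \<and> l \<notin> La G \<and> l \<notin> Lc G \<and> l \<notin> Ld G"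
  by (simp add: labels_def)

lemma in_labels:
  "l \<in> Lb G \<Longrightarrow> l \<in> labels G" "l \<in> La G \<Longrightarrow> l \<in> labels G"
  "l \<in> Lc G \<Longrightarrow> l \<in> labels G" "l \<in> Ld G \<Longrightarrow> l \<in> labels G"
  by (simp_all add: labels_def)

lemma single_edge_cfg:
  assumes "G = \<lparr>Lb = {o'}, La = A, Lc = C, Ld = {}, lin = i, lout = o', triples = {(i, act, o')}\<rparr>"
    and "i \<noteq> o'" "A \<union> C = {i}"
    and "node_ok P V False (i \<in> A) (i \<in> C) False {(act, o')}"
  shows "cfg_ok P V G"
proof -
  have "out_edges G i = {(act, o')}" using assms(1) by (auto simp: out_edges_def)
  moreover have "labels G = {i, o'}" using assms(1,3) by (auto simp: labels_def)
  moreover have "o' \<notin> A" "o' \<notin> C" using assms(2,3) by auto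
  ultimately show ?thesis using assms unfolding cfg_ok_def by auto
qed

text \<open>Except for the final \<open>lout\<close>, each label either has only edges added by the
  construction at hand or is nonterminal in exactly one part, from which it inherits its
  node.\<close>

lemma stmt_cfg_ok:
  "stmt_cfg P Q G \<Longrightarrow> wf_stmt P Q \<Longrightarrow> stmt_vars Q \<subseteq> V \<Longrightarrow> cfg_ok P V G"
proof (induction rule: stmt_cfg.induct)
  case (skip i o')
  then show ?case by (intro single_edge_cfg[OF refl]) (auto intro: node_ok.intros)
next
  case (assign i o' x e)
  then have "\<nu>(x := eval e \<nu>) \<in> V \<rightarrow>\<^sub>E UNIV" if "\<nu> \<in> V \<rightarrow>\<^sub>E UNIV" for \<nu>
    using that by (auto simp: PiE_def extensional_def)
  then have "node_ok P V False True False False {(Update (\<lambda>\<nu>. \<nu>(x := eval e \<nu>)), o')}"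
    by (rule node_ok.update)
  then show ?case using assign by (intro single_edge_cfg[OF refl]) auto
next
  case (call i o' g es)
  have "call_val P g es \<nu> \<in> vals P g" for \<nu>
    unfolding call_val_def vals_def by simp
  then show ?case using call
    by (intro single_edge_cfg[OF refl]) (auto intro: node_ok.intros)
next
  case (seq Q1 G1 Q2 G2)
  let ?G = "\<lparr>Lb = (Lb G1 - {lout G1}) \<union> Lb G2, La = La G1 \<union> La G2,
        Lc = Lc G1 \<union> Lc G2, Ld = Ld G1 \<union> Ld G2, lin = lin G1, lout = lout G2,
        triples = triples G1 \<union> triples G2\<rparr>"
  have ok: "cfg_ok P V G1" "cfg_ok P V G2" using seq by auto
  note D1 = cfg_okD[OF ok(1)] and D2 = cfg_okD[OF ok(2)]
  have sep: "l \<in> labels G1 \<Longrightarrow> l \<in> labels G2 \<Longrightarrow> l = lout G1" for l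
    using seq.hyps(3,4) by auto
  have lab: "labels ?G = labels G1 \<union> labels G2"
    using D2(8) unfolding seq.hyps(3) labels_def by simp blast
  have "label_ok P V ?G l" if l: "l \<in> labels ?G" "l \<noteq> lout G2" for l
  proof (cases "l \<in> labels G2")
    case True
    \<comment> \<open>The merged label \<open>lout G1 = lin G2\<close> has no edge in
      \<open>G1\<close> and gives up its branching type there, so \<open>G2\<close> alone decides
      its node.\<close>
    have "l = lout G1 \<or> l \<notin> labels G1" using True sep by blast
    then have "l \<notin> Lb G1 - {lout G1}" "l \<notin> La G1" "l \<notin> Lc G1" "l \<notin> Ld G1"
      "(l, a, l') \<notin> triples G1" for a l'
      using D1(1)[of l a l'] D1(2)[of l a l'] D1(5-7) label_sets[of l G1] by blast+
    then show ?thesis by (intro label_ok_mono[OF D2(10)[OF True l(2)]]) auto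
  next
    case False
    then have 1: "l \<in> labels G1" "l \<noteq> lout G1" using l lab seq.hyps(3) D2(8) by auto
    have "(l, a, l') \<notin> triples G2" for a l' using False D2(1) by blast
    then show ?thesis
      using 1 label_sets[OF False] by (intro label_ok_mono[OF D1(10)[OF 1]]) auto
  qed
  moreover have "lout G2 \<notin> labels G1"
    using sep[of "lout G2"] in_labels(1)[OF D2(4)] D2(9) seq.hyps(3) by auto
  moreover have "lin G1 \<noteq> lout G2"
    using \<open>lout G2 \<notin> labels G1\<close> D1(8) by auto
  ultimately show ?case
    using lab D1(1,3,8) D2(1-7) label_sets[of "lout G2" G1] unfolding cfg_ok_def by auto
next
  case (cond Q1 G1 Q2 G2 o' i \<phi>)
  let ?G = "\<lparr>Lb = insert i (Lb G1 \<union> Lb G2), La = La G1 \<union> La G2,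
        Lc = Lc G1 \<union> Lc G2, Ld = Ld G1 \<union> Ld G2, lin = i, lout = o',
        triples = {(i, Guard \<phi>, lin G1), (i, Guard (Neg \<phi>), lin G2)} \<union> triples G1 \<union> triples G2\<rparr>"
  have ok: "cfg_ok P V G1" "cfg_ok P V G2" using cond by auto
  note D1 = cfg_okD[OF ok(1)] and D2 = cfg_okD[OF ok(2)]
  have sep: "l \<in> labels G1 \<Longrightarrow> l \<in> labels G2 \<Longrightarrow> l = o'" for l using cond.hyps(5) by blast
  have i: "i \<notin> labels G1" "i \<notin> labels G2" using cond.hyps(6) by auto
  have lab: "labels ?G = insert i (labels G1 \<union> labels G2)" by (auto simp: labels_def)
  have "label_ok P V ?G l" if l: "l \<in> labels ?G" "l \<noteq> o'" for l
  proof -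
    consider "l = i" | "l \<in> labels G1" "l \<noteq> i" "l \<notin> labels G2" | "l \<in> labels G2" "l \<noteq> i" "l \<notin> labels G1"
      using l lab sep i by blast
    then show ?thesis
    proof cases
      case 1
      have "out_edges ?G i = {(Guard \<phi>, lin G1), (Guard (Neg \<phi>), lin G2)}"
        using i D1(1) D2(1) by (auto simp: out_edges_def)
      then show ?thesis using 1 label_sets[OF i(1)] label_sets[OF i(2)] by (simp add: node_ok.guard)
    next
      case 2
      then have "l \<noteq> lout G1" using l cond.hyps(3) by simp
      from D1(10)[OF 2(1) this] show ?thesis
        by (rule label_ok_mono) (use 2 label_sets[OF 2(3)] D2(1) in auto)
    next
      case 3
      then have "l \<noteq> lout G2" using l cond.hyps(4) by simp
      from D2(10)[OF 3(1) this] show ?thesis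
        by (rule label_ok_mono) (use 3 label_sets[OF 3(3)] D1(1) in auto)
    qed
  qed
  moreover have "i \<noteq> o'" using i in_labels(1)[OF D1(4)] cond.hyps(3) by auto
  ultimately show ?case
    using lab i D1(1-8) D2(1-8) cond.hyps(3,4) unfolding cfg_ok_def by auto
next
  case (choice Q1 G1 Q2 G2 o' i)
  let ?G = "\<lparr>Lb = Lb G1 \<union> Lb G2, La = La G1 \<union> La G2,
        Lc = Lc G1 \<union> Lc G2, Ld = insert i (Ld G1 \<union> Ld G2), lin = i, lout = o',
        triples = {(i, Star, lin G1), (i, Star, lin G2)} \<union> triples G1 \<union> triples G2\<rparr>"
  have ok: "cfg_ok P V G1" "cfg_ok P V G2" using choice by auto
  note D1 = cfg_okD[OF ok(1)] and D2 = cfg_okD[OF ok(2)]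
  have sep: "l \<in> labels G1 \<Longrightarrow> l \<in> labels G2 \<Longrightarrow> l = o'" for l using choice.hyps(5) by blast
  have i: "i \<notin> labels G1" "i \<notin> labels G2" using choice.hyps(6) by auto
  have lab: "labels ?G = insert i (labels G1 \<union> labels G2)" by (auto simp: labels_def)
  have "label_ok P V ?G l" if l: "l \<in> labels ?G" "l \<noteq> o'" for l
  proof -
    consider "l = i" | "l \<in> labels G1" "l \<noteq> i" "l \<notin> labels G2" | "l \<in> labels G2" "l \<noteq> i" "l \<notin> labels G1"
      using l lab sep i by blast
    then show ?thesis
    proof cases
      case 1
      have "out_edges ?G i = {(Star, lin G1), (Star, lin G2)}"
        using i D1(1) D2(1) by (auto simp: out_edges_def)
      then show ?thesis using 1 label_sets[OF i(1)] label_sets[OF i(2)] by (simp add: node_ok.star)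
    next
      case 2
      then have "l \<noteq> lout G1" using l choice.hyps(3) by simp
      from D1(10)[OF 2(1) this] show ?thesis
        by (rule label_ok_mono) (use 2 label_sets[OF 2(3)] D2(1) in auto)
    next
      case 3
      then have "l \<noteq> lout G2" using l choice.hyps(4) by simp
      from D2(10)[OF 3(1) this] show ?thesis
        by (rule label_ok_mono) (use 3 label_sets[OF 3(3)] D1(1) in auto)
    qed
  qed
  moreover have "i \<noteq> o'" using i in_labels(1)[OF D1(4)] choice.hyps(3) by auto
  ultimately show ?case
    using lab i D1(1-8) D2(1-8) choice.hyps(3,4) unfolding cfg_ok_def by auto
next
  case (while Q G o' \<phi>)
  let ?G = "\<lparr>Lb = insert o' (Lb G), La = La G, Lc = Lc G, Ld = Ld G, lin = lout G, lout = o',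
        triples = {(lout G, Guard \<phi>, lin G), (lout G, Guard (Neg \<phi>), o')} \<union> triples G\<rparr>"
  have ok: "cfg_ok P V G" using while by auto
  note D = cfg_okD[OF ok]
  have lab: "labels ?G = insert o' (labels G)" by (auto simp: labels_def)
  have "label_ok P V ?G l" if l: "l \<in> labels ?G" "l \<noteq> o'" for l
  proof (cases "l = lout G")
    case True
    \<comment> \<open>The loop head had no outgoing triple in the body, so the two new guarded edges
      are all it has.\<close>
    have "out_edges ?G (lout G) = {(Guard \<phi>, lin G), (Guard (Neg \<phi>), o')}"
      using D(2) by (auto simp: out_edges_def)
    then show ?thesis using True D(4-7) by (simp add: node_ok.guard)
  next
    case False
    have "l \<in> labels G" using l unfolding lab by simp
    from D(10)[OF this False] show ?thesis
      by (rule label_ok_mono) (use l False in auto)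
  qed
  moreover have "o' \<noteq> lout G" using while.hyps(2) in_labels(1)[OF D(4)] by auto
  moreover have "(\<forall>l a l'. (l, a, l') \<in> triples ?G \<longrightarrow> l \<in> labels ?G - {o'} \<and> l' \<in> labels ?G)"
    unfolding lab using D(1,3,8) while.hyps(2) in_labels(1)[OF D(4)] by auto
  ultimately show ?case
    unfolding cfg_ok_def using lab label_sets[OF while.hyps(2)] in_labels(1)[OF D(4)]
    by (simp, blast)
qed

lemma Neg_neq:
  "Neg \<psi> \<noteq> \<psi>" "\<psi> \<noteq> Neg \<psi>" "Neg (Neg \<psi>) \<noteq> \<psi>" "\<psi> \<noteq> Neg (Neg \<psi>)"
  by (auto dest: arg_cong[of _ _ size])

text \<open>The crossed match of the two pairs would give \<open>Neg (Neg \<psi>) = \<psi>\<close>,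
  which is impossible for syntactic negation. Hence the edge set of a branching label determines
  which target belongs to which truth value.\<close>

lemma guard_edges_eq_iff:
  "{(Guard \<phi>, l1), (Guard (Neg \<phi>), l2)} = {(Guard \<psi>, m1), (Guard (Neg \<psi>), m2)} \<longleftrightarrow>
     \<phi> = \<psi> \<and> l1 = m1 \<and> l2 = m2"
  by (simp add: doubleton_eq_iff) (metis Neg_neq(3))

section \<open>Paths of steps that leave a nonempty configuration\<close>

definition live_step ::
  "('f \<Rightarrow> ('l, 'f, 'v) cfg) \<Rightarrow> ('f, 'l, 'v) config \<Rightarrow> ('f, 'l, 'v) config \<Rightarrow> bool" where
  "live_step G w w' \<longleftrightarrow> w \<noteq> [] \<and> step G w w'"

text \<open>The rules change only the top and carry the rest along. The empty configuration is
  excluded because its self-loop does not carry over to \<open>w\<close>.\<close>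

lemma step_append:
  assumes "live_step G u u'"
  shows "live_step G (u @ w) (u' @ w)"
proof -
  have "step G u u'" "u \<noteq> []" using assms by (auto simp: live_step_def)
  then have "step G (u @ w) (u' @ w)"
  proof cases
    case (assign l f h l' \<nu> v)
    then show ?thesis using step.assign[of l G f h l' \<nu> "v @ w"] by simp
  next
    case (call l f g h l' \<nu> v)
    then show ?thesis using step.call[of l G f g h l' \<nu> "v @ w"] by simp
  next
    case (branch_true l f \<phi> l1 l2 \<nu> v)
    then show ?thesis using step.branch_true[of l G f \<phi> l1 l2 \<nu> "v @ w"] by simp
  next
    case (branch_false l f \<phi> l1 l2 \<nu> v)
    then show ?thesis using step.branch_false[of l G f \<phi> l1 l2 \<nu> "v @ w"] by simp
  next
    case (demonic l f l' \<nu> v)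
    then show ?thesis using step.demonic[of l G f l' \<nu> "v @ w"] by simp
  qed simp
  then show ?thesis using assms by (simp add: live_step_def)
qed

lemma live_path_append:
  "(live_step G ^^ n) u u' \<Longrightarrow> (live_step G ^^ n) (u @ w) (u' @ w)"
proof (induction n arbitrary: u')
  case (Suc n)
  then obtain v where "(live_step G ^^ n) u v" "live_step G v u'" by auto
  from relpowp_Suc_I[OF Suc.IH[OF this(1)] step_append[OF this(2)]] show ?case .
qed simp

lemma live_path_prefix:
  assumes "(live_step G ^^ n) u u'" "m \<le> n"
  shows "\<exists>v. (live_step G ^^ m) u v"
proof -
  obtain k where "n = m + k" using le_Suc_ex[OF assms(2)] by blast
  then show ?thesis using assms(1) by (auto simp: relpowp_add)
qed

section \<open>Bounding extended numbers through natural ones\<close>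

lemma history_nonempty: "history G c \<pi> n \<noteq> []"
  by (cases n) auto

text \<open>Lower bounds avoid a case distinction on termination: an infimum is at least
  \<open>n\<close> exactly when no smaller index occurs in the set.\<close>

lemma term_time_ge: "enat n \<le> term_time G c \<pi> \<longleftrightarrow> (\<forall>j<n. run G c \<pi> j \<noteq> [])"
  unfolding term_time_def le_INF_iff by (auto simp: not_less[symmetric])

lemma enat_le_if_finite_le: "(\<And>n. enat n \<le> x \<Longrightarrow> enat n \<le> y) \<Longrightarrow> x \<le> y"
  by (cases x; cases y) (auto, metis Suc_n_not_le_n enat_ord_simps(1))

text \<open>A finite \<open>x\<close> is itself one of the tested values; for infinite
  \<open>x\<close>, the value \<open>y\<close> is at least every natural number and so is
  \<open>top\<close>.\<close>

lemma ennreal_of_enat_leI: "(\<And>n. enat n \<le> x \<Longrightarrow> of_nat n \<le> y) \<Longrightarrow> ennreal_of_enat x \<le> y"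
proof (cases x)
  case infinity
  moreover assume "\<And>n. enat n \<le> x \<Longrightarrow> of_nat n \<le> y"
  ultimately have "\<not> y < of_nat n" for n by (simp add: not_less)
  then have "y = top" using ennreal_Ex_less_of_nat[of y] less_top by blast
  then show ?thesis by simp
qed simp

text \<open>The deleted terms are nonnegative.\<close>

lemma sum_list_prune: "sum_list (map g (prune G w)) \<le> (sum_list (map g w) :: ennreal)"
  unfolding prune_def by (induction w) (auto intro: add_mono add_increasing)

section \<open>Steps of a well-formed program: inversion, existence, uniqueness\<close>

locale program_graph =
  fixes P :: "('f, 'v) program" and G :: "'f \<Rightarrow> ('l, 'f, 'v) cfg"
  assumes wf: "wf_program P" and cfg: "program_cfg P G"
begin

lemma graph_ok: "f \<in> fnames P \<Longrightarrow> cfg_ok P (fvars P f) (G f)"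
  using wf cfg unfolding wf_program_def program_cfg_def
  by (intro stmt_cfg_ok[of P "body P f"]) (auto simp: fvars_def)

lemma configs_Cons:
  "(f, l, \<nu>) # w \<in> configs P G \<longleftrightarrow>
     f \<in> fnames P \<and> l \<in> labels (G f) \<and> \<nu> \<in> vals P f \<and> l \<noteq> lout (G f) \<and> w \<in> configs P G"
  unfolding configs_def by (auto simp: stack_elems_def non_terminal_def)

lemma configs_append: "u @ w \<in> configs P G \<longleftrightarrow> u \<in> configs P G \<and> w \<in> configs P G"
  unfolding configs_def by auto

lemma Nil_configs: "[] \<in> configs P G"
  unfolding configs_def by simp

lemma prune_configs: "set ws \<subseteq> stack_elems P G \<Longrightarrow> prune G ws \<in> configs P G"
  unfolding configs_def prune_def by auto

text \<open>\<open>cfg_ok\<close> in a form for case analysis. Excluding the other types leaves one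
  kind of \<open>step\<close> rule; the facts on targets and valuations keep successors among the
  stack elements.\<close>

lemma node_cases:
  assumes "f \<in> fnames P" "l \<in> labels (G f)" "l \<noteq> lout (G f)"
  obtains
    (update) h l' where "l \<in> La (G f)" "l \<notin> Lb (G f) \<union> Lc (G f) \<union> Ld (G f)"
      "out_edges (G f) l = {(Update h, l')}" "l' \<in> labels (G f)"
      "\<And>\<nu>. \<nu> \<in> vals P f \<Longrightarrow> h \<nu> \<in> vals P f"
  | (enter) g h l' where "l \<in> Lc (G f)" "l \<notin> Lb (G f) \<union> La (G f) \<union> Ld (G f)"
      "out_edges (G f) l = {(Enter g h, l')}" "l' \<in> labels (G f)" "g \<in> fnames P"
      "\<And>\<nu>. h \<nu> \<in> vals P g"
  | (guard) \<phi> l1 l2 where "l \<in> Lb (G f)" "l \<notin> La (G f) \<union> Lc (G f) \<union> Ld (G f)"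
      "out_edges (G f) l = {(Guard \<phi>, l1), (Guard (Neg \<phi>), l2)}"
      "l1 \<in> labels (G f)" "l2 \<in> labels (G f)"
  | (star) l1 l2 where "l \<in> Ld (G f)" "l \<notin> La (G f) \<union> Lb (G f) \<union> Lc (G f)"
      "out_edges (G f) l = {(Star, l1), (Star, l2)}" "l1 \<in> labels (G f)" "l2 \<in> labels (G f)"
proof -
  note D = cfg_okD[OF graph_ok[OF assms(1)]]
  have tgt: "l' \<in> labels (G f)" if "(a, l') \<in> out_edges (G f) l" for a l'
    using that D(3) unfolding out_edges_def by auto
  from D(10)[OF assms(2,3)] show thesis
  proof cases
    case (update h l')
    then show ?thesis using that(1)[of h l'] tgt unfolding vals_def by auto
  next
    case (enter g h l')
    then show ?thesis using that(2)[of g h l'] tgt by auto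
  next
    case (guard \<phi> l1 l2)
    then show ?thesis using that(3)[of \<phi> l1 l2] tgt by auto
  next
    case (star l1 l2)
    then show ?thesis using that(4)[of l1 l2] tgt by auto
  qed
qed

lemma out_edges_iff: "(l, a, l') \<in> triples (G f) \<longleftrightarrow> (a, l') \<in> out_edges (G f) l"
  unfolding out_edges_def by simp

text \<open>Inversion with the exact edge set, so that two steps from one configuration can be
  compared through \<open>out_edges\<close>. Both branching rules fall under one case with a
  conditional target, and the new letters are given before pruning, as \<open>prune_configs\<close>
  expects them.\<close>

lemma step_cases:
  assumes "step G ((f, l, \<nu>) # w) w'" "(f, l, \<nu>) # w \<in> configs P G"
  obtains
    (update) h l' where "l \<in> La (G f)" "l \<notin> Ld (G f)" "out_edges (G f) l = {(Update h, l')}"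
      "(f, l', h \<nu>) \<in> stack_elems P G" "w' = prune G [(f, l', h \<nu>)] @ w"
  | (enter) g h l' where "l \<in> Lc (G f)" "l \<notin> Ld (G f)" "out_edges (G f) l = {(Enter g h, l')}"
      "(g, lin (G g), h \<nu>) \<in> stack_elems P G" "(f, l', \<nu>) \<in> stack_elems P G"
      "w' = prune G [(g, lin (G g), h \<nu>), (f, l', \<nu>)] @ w"
  | (guard) \<phi> l1 l2 where "l \<in> Lb (G f)" "l \<notin> Ld (G f)"
      "out_edges (G f) l = {(Guard \<phi>, l1), (Guard (Neg \<phi>), l2)}"
      "(f, l1, \<nu>) \<in> stack_elems P G" "(f, l2, \<nu>) \<in> stack_elems P G"
      "w' = prune G [(f, if \<nu> \<Turnstile> \<phi> then l1 else l2, \<nu>)] @ w"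
  | (star) l1 l2 where "l \<in> Ld (G f)" "out_edges (G f) l = {(Star, l1), (Star, l2)}"
      "(f, l1, \<nu>) \<in> stack_elems P G" "(f, l2, \<nu>) \<in> stack_elems P G"
      "w' = prune G [(f, l1, \<nu>)] @ w \<or> w' = prune G [(f, l2, \<nu>)] @ w"
proof -
  have a: "f \<in> fnames P" "l \<in> labels (G f)" "l \<noteq> lout (G f)" "\<nu> \<in> vals P f"
    using assms(2) by (auto simp: configs_Cons)
  from a(1-3) show thesis
  proof (cases rule: node_cases)
    case (update h l')
    show ?thesis
    proof (rule that(1)[OF update(1) _ update(3)])
      show "w' = prune G [(f, l', h \<nu>)] @ w"
        using assms(1) by cases (use update(1-3) in \<open>auto simp: out_edges_iff\<close>)
    qed (use update a in \<open>auto simp: stack_elems_def\<close>)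
  next
    case (enter g h l')
    show ?thesis
    proof (rule that(2)[OF enter(1) _ enter(3)])
      show "w' = prune G [(g, lin (G g), h \<nu>), (f, l', \<nu>)] @ w"
        using assms(1) by cases (use enter(1-3) in \<open>auto simp: out_edges_iff\<close>)
    qed (use enter a cfg_okD(8)[OF graph_ok[OF enter(5)]] in \<open>auto simp: stack_elems_def\<close>)
  next
    case (guard \<phi> l1 l2)
    show ?thesis
    proof (rule that(3)[OF guard(1) _ guard(3)])
      \<comment> \<open>The rule applied may a priori use any \<open>\<psi>\<close> such that
        \<open>\<psi>\<close> and \<open>Neg \<psi>\<close> both guard edges from \<open>l\<close>;
        \<open>Neg_neq\<close> leaves only \<open>\<psi> = \<phi>\<close>.\<close>
      show "w' = prune G [(f, if \<nu> \<Turnstile> \<phi> then l1 else l2, \<nu>)] @ w"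
        using assms(1) by cases (use guard(1-3) Neg_neq in \<open>auto simp: out_edges_iff\<close>)
    qed (use guard a in \<open>auto simp: stack_elems_def\<close>)
  next
    case (star l1 l2)
    show ?thesis
    proof (rule that(4)[OF star(1,3)])
      show "w' = prune G [(f, l1, \<nu>)] @ w \<or> w' = prune G [(f, l2, \<nu>)] @ w"
        using assms(1) by cases (use star(1-3) in \<open>auto simp: out_edges_iff\<close>)
    qed (use star a in \<open>auto simp: stack_elems_def\<close>)
  qed
qed

lemma step_exists:
  assumes "w \<in> configs P G"
  shows "\<exists>w'. step G w w'"
proof (cases w)
  case Nil
  then show ?thesis by (auto intro: step.empty)
next
  case (Cons c v)
  obtain f l \<nu> where c: "c = (f, l, \<nu>)" by (cases c)
  have "f \<in> fnames P" "l \<in> labels (G f)" "l \<noteq> lout (G f)"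
    using assms Cons c by (auto simp: configs_Cons)
  then show ?thesis
  proof (cases rule: node_cases)
    case (update h l')
    then have "(l, Update h, l') \<in> triples (G f)" by (simp add: out_edges_iff)
    then show ?thesis unfolding Cons c using update(1) by (blast intro: step.assign)
  next
    case (enter g h l')
    then have "(l, Enter g h, l') \<in> triples (G f)" by (simp add: out_edges_iff)
    then show ?thesis unfolding Cons c using enter(1) by (blast intro: step.call)
  next
    case (guard \<phi> l1 l2)
    then have "(l, Guard \<phi>, l1) \<in> triples (G f)" "(l, Guard (Neg \<phi>), l2) \<in> triples (G f)"
      by (simp_all add: out_edges_iff)
    then show ?thesis unfolding Cons c
      using step.branch_true[of l G f \<phi> l1 l2 \<nu> v] step.branch_false[of l G f \<phi> l1 l2 \<nu> v] guard(1)
      by blast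
  next
    case (star l1 l2)
    then have "(l, Star, l1) \<in> triples (G f)" by (simp add: out_edges_iff)
    then show ?thesis unfolding Cons c using star(1) by (blast intro: step.demonic)
  qed
qed

text \<open>Makes the description operator in \<open>next_config\<close> meaningful. Away from
  demonic labels the edge set fixes the successor, at branching labels by
  \<open>guard_edges_eq_iff\<close>.\<close>

lemma step_unique:
  assumes "w \<in> configs P G" "\<not> demonic_top G w" "step G w w1" "step G w w2"
  shows "w1 = w2"
proof (cases w)
  case Nil
  then show ?thesis using assms(3,4) by (auto elim: step.cases)
next
  case (Cons c v)
  obtain f l \<nu> where c: "c = (f, l, \<nu>)" by (cases c)
  have s: "step G ((f, l, \<nu>) # v) w1" "step G ((f, l, \<nu>) # v) w2" "(f, l, \<nu>) # v \<in> configs P G"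
    and d: "l \<notin> Ld (G f)"
    using assms Cons c by (auto simp: demonic_top_def)
  show ?thesis
    using s(1,3)
  proof (cases rule: step_cases)
    case 1: (update h l')
    show ?thesis using s(2,3) by (cases rule: step_cases) (use d 1(3,5) in simp_all)
  next
    case 1: (enter g h l')
    show ?thesis using s(2,3) by (cases rule: step_cases) (use d 1(3,6) in simp_all)
  next
    case 1: (guard \<phi> l1 l2)
    show ?thesis using s(2,3)
      by (cases rule: step_cases) (use d 1(3,6) in \<open>simp_all add: guard_edges_eq_iff\<close>)
  next
    case star
    then show ?thesis using d by simp
  qed
qed

lemma step_configs:
  assumes "w \<in> configs P G" "step G w w'"
  shows "w' \<in> configs P G"
proof (cases w)
  case Nil
  then show ?thesis using assms by (auto elim: step.cases simp: Nil_configs)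
next
  case (Cons c v)
  obtain f l \<nu> where c: "c = (f, l, \<nu>)" by (cases c)
  have s: "step G ((f, l, \<nu>) # v) w'" "(f, l, \<nu>) # v \<in> configs P G" and v: "v \<in> configs P G"
    using assms Cons c by (auto simp: configs_Cons)
  have p: "prune G ws @ v \<in> configs P G" if "set ws \<subseteq> stack_elems P G" for ws
    using prune_configs[OF that] v by (simp add: configs_append)
  show ?thesis
  proof (rule step_cases[OF s])
  qed (simp_all add: p, use p in fastforce)
qed

section \<open>Prolonging and stacking paths\<close>

lemma live_path_configs:
  "(live_step G ^^ n) u u' \<Longrightarrow> u \<in> configs P G \<Longrightarrow> u' \<in> configs P G"
proof (induction n arbitrary: u')
  case (Suc n)
  then obtain v where "(live_step G ^^ n) u v" "live_step G v u'" by auto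
  moreover from this have "v \<in> configs P G" using Suc.IH Suc.prems(2) by simp
  ultimately show ?case using step_configs[of v u'] by (simp add: live_step_def)
qed simp

text \<open>A path can get stuck only at the empty configuration, since \<open>step_exists\<close>
  continues it from any other.\<close>

lemma live_path_or_empty:
  "u \<in> configs P G \<Longrightarrow> (\<exists>k. (live_step G ^^ k) u []) \<or> (\<exists>u'. (live_step G ^^ m) u u')"
proof (induction m)
  case (Suc m)
  then consider k where "(live_step G ^^ k) u []" | v where "(live_step G ^^ m) u v" "v \<noteq> []"
    by blast
  then show ?case
  proof cases
    case 2
    then obtain v' where "step G v v'"
      using step_exists live_path_configs Suc.prems by blast
    then have "live_step G v v'" using 2(2) by (simp add: live_step_def)
    then show ?thesis using relpowp_Suc_I[OF 2(1)] by blast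
  qed auto
qed auto

lemma live_path_stack:
  assumes "(live_step G ^^ m) u u'" "(live_step G ^^ n) w w'" "u \<in> configs P G"
  shows "\<exists>v. (live_step G ^^ (m + n)) (u @ w) v"
proof -
  have "u' \<in> configs P G" using assms live_path_configs by blast
  then consider k where "(live_step G ^^ k) u' []" | v where "(live_step G ^^ n) u' v"
    using live_path_or_empty by blast
  then show ?thesis
  proof cases
    case 1
    then have "(live_step G ^^ (m + k)) u []" using assms(1) by (blast intro: relpowp_trans)
    then have "(live_step G ^^ (m + k)) (u @ w) w" by (auto dest: live_path_append[where w = w])
    \<comment> \<open>Emptying \<open>u\<close> takes \<open>k\<close> steps beyond the first
      \<open>m\<close>, so this path is \<open>k\<close> too long and is cut back to
      \<open>m + n\<close>.\<close>
    then have "(live_step G ^^ (m + k + n)) (u @ w) w'" using assms(2) by (blast intro: relpowp_trans)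
    then show ?thesis by (rule live_path_prefix) simp
  next
    case 2
    then have "(live_step G ^^ (m + n)) u v" using assms(1) by (blast intro: relpowp_trans)
    then show ?thesis using live_path_append by blast
  qed
qed

section \<open>Runs under schedulers and paths\<close>

lemma history_run:
  assumes "scheduler P G \<pi>" "c \<in> stack_elems P G"
  shows "history G c \<pi> n \<in> lists (configs P G) \<and> step G (run G c \<pi> n) (run G c \<pi> (Suc n))"
proof (induction n)
  \<comment> \<open>A scheduler is constrained only on histories made of genuine configurations, so
    membership in \<open>configs\<close> and the step property go through one induction.\<close>
  have next_step: "step G (last ws) (next_config G \<pi> ws)"
    if "ws \<in> lists (configs P G)" "ws \<noteq> []" for ws
  proof (cases "demonic_top G (last ws)")
    case True
    then show ?thesis using that assms(1) unfolding scheduler_def next_config_def by auto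
  next
    case False
    have l: "last ws \<in> configs P G" using that by auto
    then obtain w' where w': "step G (last ws) w'" using step_exists by blast
    have "step G (last ws) (THE w. step G (last ws) w)"
      by (rule theI[where P = "step G (last ws)", OF w']) (rule step_unique[OF l False _ w'])
    then show ?thesis using False unfolding next_config_def by simp
  qed
  case 0
  have "[prune G [c]] \<in> lists (configs P G)" using assms(2) prune_configs[of "[c]"] by simp
  then show ?case using next_step[of "[prune G [c]]"] by (simp add: run_def)
  case (Suc n)
  then have "history G c \<pi> (Suc n) \<in> lists (configs P G)"
    using step_configs[of "run G c \<pi> n" "run G c \<pi> (Suc n)"] history_nonempty[of G c \<pi> n]
    by (auto simp: run_def)
  then show ?case using next_step[OF _ history_nonempty, of G c \<pi> "Suc n"] by (simp add: run_def)
qed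

lemmas run_step = conjunct2[OF history_run]

lemma run_configs:
  assumes "scheduler P G \<pi>" "c \<in> stack_elems P G"
  shows "run G c \<pi> n \<in> configs P G"
  using history_run[OF assms, of n] history_nonempty[of G c \<pi> n] by (auto simp: run_def)

lemma run_live_path:
  assumes "scheduler P G \<pi>" "c \<in> stack_elems P G" "\<forall>j<n. run G c \<pi> j \<noteq> []"
  shows "(live_step G ^^ n) (prune G [c]) (run G c \<pi> n)"
  using assms(3)
proof (induction n)
  case 0
  then show ?case by (simp add: run_def)
next
  case (Suc n)
  then show ?case using run_step[OF assms(1,2), of n] by (auto simp: live_step_def)
qed

text \<open>A path may leave the same configuration differently on different visits, which is why
  the scheduler compares the whole history with the path.\<close>

lemma path_scheduler:
  assumes c: "c \<in> stack_elems P G" and path: "(live_step G ^^ n) (prune G [c]) w"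
  obtains \<pi> where "scheduler P G \<pi>" "\<forall>j<n. run G c \<pi> j \<noteq> []"
proof -
  obtain p where p: "p 0 = prune G [c]" "\<And>i. i < n \<Longrightarrow> live_step G (p i) (p (Suc i))"
    using path unfolding relpowp_fun_conv by auto
  have conf: "i \<le> n \<Longrightarrow> p i \<in> configs P G" for i
    by (induction i) (use p prune_configs[of "[c]"] c step_configs in \<open>auto simp: live_step_def\<close>)
  \<comment> \<open>A history \<open>map p [0..<Suc i]\<close> has length \<open>Suc i\<close>, so
    \<open>p (length ws)\<close> is the next point of the path. On other histories any successor
    will do, but it must be one, since \<open>scheduler\<close> also speaks about histories off the
    path.\<close>
  define \<pi> where "\<pi> ws = (if \<exists>i<n. ws = map p [0..<Suc i] then p (length ws)
      else SOME w. step G (last ws) w)" for ws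
  have "scheduler P G \<pi>"
    unfolding scheduler_def
  proof (intro ballI impI)
    fix ws assume ws: "ws \<in> lists (configs P G)" "ws \<noteq> [] \<and> demonic_top G (last ws)"
    then have "last ws \<in> configs P G" by auto
    then have "\<exists>w. step G (last ws) w" by (rule step_exists)
    then have "step G (last ws) (SOME w. step G (last ws) w)" by (rule someI_ex)
    then show "step G (last ws) (\<pi> ws)" using p(2) unfolding \<pi>_def by (auto simp: live_step_def)
  qed
  moreover have hist: "j \<le> n \<Longrightarrow> history G c \<pi> j = map p [0..<Suc j]" for j
  proof (induction j)
    case (Suc j)
    let ?ws = "map p [0..<Suc j]"
    have j: "j < n" and IH: "history G c \<pi> j = ?ws" using Suc by auto
    have s: "step G (p j) (p (Suc j))" using p(2)[OF j] by (simp add: live_step_def)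
    have "next_config G \<pi> ?ws = p (Suc j)"
    proof (cases "demonic_top G (p j)")
      case True
      have "\<pi> ?ws = p (length ?ws)" unfolding \<pi>_def using j by (metis (lifting))
      then show ?thesis using True unfolding next_config_def by simp
    next
      case False
      \<comment> \<open>Here \<open>\<pi>\<close> is not consulted; uniqueness of the successor
        keeps the run on the path.\<close>
      have "(THE w. step G (p j) w) = p (Suc j)"
        using s by (rule the_equality) (use step_unique[OF conf False _ s] j in simp)
      then show ?thesis using False unfolding next_config_def by simp
    qed
    then show ?case using IH by simp
  qed (simp add: p(1))
  moreover have "\<forall>j<n. run G c \<pi> j \<noteq> []"
    using hist p(2) by (auto simp: run_def live_step_def)
  ultimately show ?thesis using that by blast
qed

text \<open>With natural bounds each direction involves one scheduler and only a finite part of its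
  run.\<close>

lemma worst_time_ge:
  assumes "c \<in> stack_elems P G"
  shows "enat n \<le> worst_time P G c \<longleftrightarrow> (\<exists>w. (live_step G ^^ n) (prune G [c]) w)"
proof
  assume le: "enat n \<le> worst_time P G c"
  show "\<exists>w. (live_step G ^^ n) (prune G [c]) w"
  proof (cases n)
    case (Suc m)
    \<comment> \<open>As a strict bound by \<open>m\<close>, the inequality is already witnessed by
      a single scheduler.\<close>
    then have "enat m < worst_time P G c" using le by (metis Suc_ile_eq)
    then obtain \<pi> where "scheduler P G \<pi>" "enat m < term_time G c \<pi>"
      unfolding worst_time_def less_SUP_iff by auto
    then have "enat n \<le> term_time G c \<pi>" using Suc by (simp add: Suc_ile_eq)
    then show ?thesis
      using run_live_path[OF \<open>scheduler P G \<pi>\<close> assms, of n] unfolding term_time_ge by blast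
  qed auto
next
  assume "\<exists>w. (live_step G ^^ n) (prune G [c]) w"
  then obtain \<pi> where "scheduler P G \<pi>" "enat n \<le> term_time G c \<pi>"
    using path_scheduler[OF assms] term_time_ge by metis
  then show "enat n \<le> worst_time P G c"
    unfolding worst_time_def by (intro SUP_upper2[of \<pi>]) auto
qed

section \<open>Completeness: the worst-case time is a measure function\<close>

lemma worst_time_terminal:
  assumes "(f, lout (G f), \<nu>) \<in> stack_elems P G"
  shows "worst_time P G (f, lout (G f), \<nu>) = 0"
proof (rule ccontr)
  assume "worst_time P G (f, lout (G f), \<nu>) \<noteq> 0"
  then have "enat 1 \<le> worst_time P G (f, lout (G f), \<nu>)"
    by (metis ileI1 i0_less one_eSuc one_enat_def)
  then show False
    unfolding worst_time_ge[OF assms] by (auto simp: prune_def non_terminal_def live_step_def)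
qed

text \<open>A path of length \<open>m\<close> from \<open>d\<close> becomes one of length
  \<open>Suc m\<close> from \<open>c\<close>. This serves C2, C4 and C5.\<close>

lemma worst_time_step:
  assumes c: "c \<in> stack_elems P G" "non_terminal G c" and d: "d \<in> stack_elems P G"
    and s: "step G [c] (prune G [d])"
  shows "worst_time P G d + 1 \<le> worst_time P G c"
proof (rule enat_le_if_finite_le)
  fix n assume n: "enat n \<le> worst_time P G d + 1"
  show "enat n \<le> worst_time P G c"
  proof (cases n)
    case (Suc m)
    then have "enat m \<le> worst_time P G d"
      using n by (cases "worst_time P G d") (auto simp: one_enat_def)
    then obtain w where "(live_step G ^^ m) (prune G [d]) w" using worst_time_ge[OF d] by blast
    then have "(live_step G ^^ Suc m) [c] w"
      using s by (intro relpowp_Suc_I2[of _ _ "prune G [d]"]) (auto simp: live_step_def)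
    then show ?thesis
      using Suc c unfolding worst_time_ge[OF c(1)] by (auto simp: prune_def simp del: relpowp.simps)
  qed (simp add: zero_enat_def[symmetric])
qed

text \<open>For C3: the stack after a call is the pruned callee followed by the pruned return point,
  so \<open>live_path_stack\<close> adds up the lengths of their paths.\<close>

lemma worst_time_call:
  assumes c: "c \<in> stack_elems P G" "non_terminal G c"
    and d: "d \<in> stack_elems P G" and e: "e \<in> stack_elems P G"
    and s: "step G [c] (prune G [d, e])"
  shows "1 + worst_time P G d + worst_time P G e \<le> worst_time P G c"
proof -
  have main: "enat (1 + m + n) \<le> worst_time P G c"
    if m: "enat m \<le> worst_time P G d" and n: "enat n \<le> worst_time P G e" for m n
  proof -
    obtain w w' where w: "(live_step G ^^ m) (prune G [d]) w" "(live_step G ^^ n) (prune G [e]) w'"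
      using iffD1[OF worst_time_ge[OF d] m] iffD1[OF worst_time_ge[OF e] n] by blast
    have "prune G [d] \<in> configs P G" using d by (intro prune_configs) simp
    from live_path_stack[OF w this] obtain v
      where "(live_step G ^^ (m + n)) (prune G [d] @ prune G [e]) v" ..
    then have "(live_step G ^^ (m + n)) (prune G [d, e]) v"
      by (simp add: prune_def split: if_splits)
    then have "(live_step G ^^ Suc (m + n)) [c] v"
      using s by (intro relpowp_Suc_I2[of _ _ "prune G [d, e]"]) (auto simp: live_step_def)
    then show ?thesis
      using c unfolding worst_time_ge[OF c(1)] by (auto simp: prune_def simp del: relpowp.simps)
  qed
  show ?thesis
  proof (cases "worst_time P G d = \<infinity> \<or> worst_time P G e = \<infinity>")
    case False
    then show ?thesis using main by (auto simp: one_enat_def)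
  next
    case True
    \<comment> \<open>When one of the two times is infinite, \<open>n\<close> is taken from that
      summand alone, with \<open>0\<close> for the other.\<close>
    have "enat n \<le> worst_time P G c" for n
    proof -
      have "enat (1 + n + 0) \<le> worst_time P G c \<or> enat (1 + 0 + n) \<le> worst_time P G c"
        using True main[of n 0] main[of 0 n] by (auto simp: zero_enat_def[symmetric])
      then show ?thesis by (auto simp: Suc_ile_eq)
    qed
    then show ?thesis by (rule enat_le_if_finite_le)
  qed
qed

lemma measure_worst_time:
  "measure_function P G fstar \<phi>star (\<lambda>c. ennreal_of_enat (worst_time P G c))"
proof -
  \<comment> \<open>The embedding into \<open>ennreal\<close> preserves sums and order, so the
    conditions can be proved over \<open>enat\<close>.\<close>
  have plus: "ennreal_of_enat x + 1 \<le> ennreal_of_enat y \<longleftrightarrow> x + 1 \<le> y" for x y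
    by (metis ennreal_of_enat_1 ennreal_of_enat_plus ennreal_of_enat_le_iff)
  have plus2: "1 + ennreal_of_enat x + ennreal_of_enat y \<le> ennreal_of_enat z \<longleftrightarrow> 1 + x + y \<le> z" for x y z
    by (metis ennreal_of_enat_1 ennreal_of_enat_plus ennreal_of_enat_le_iff)
  let ?T = "\<lambda>c. ennreal_of_enat (worst_time P G c)"
  show ?thesis
    unfolding measure_function_def
  proof (intro ballI case_prodI2, goal_cases)
    case (1 x f y l \<nu>)
    then have c: "(f, l, \<nu>) \<in> stack_elems P G" by simp
    have a: "f \<in> fnames P" "l \<in> labels (G f)" "\<nu> \<in> vals P f"
      using c by (auto simp: stack_elems_def)
    have se: "(f, l', \<nu>) \<in> stack_elems P G" if "(l, act, l') \<in> triples (G f)" for act l'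
      using that a cfg_okD(3)[OF graph_ok[OF a(1)]] by (auto simp: stack_elems_def)
    have nt: "non_terminal G (f, l, \<nu>)" if "l \<noteq> lout (G f)" using that by (simp add: non_terminal_def)
    \<comment> \<open>The conditions are checked on one-letter stacks, whence the rest
      \<open>[]\<close> in the step rules below.\<close>
    note step = worst_time_step[OF c nt, folded plus]
    show ?case
    proof (intro conjI impI allI)
      assume "l = lout (G f)"
      then show "?T (f, l, \<nu>) = 0" using worst_time_terminal c by auto
    next
      fix h l' assume l: "l \<in> La (G f) - {lout (G f)} \<and> \<nu> \<in> reach_vals P G fstar \<phi>star f l"
        and t: "(l, Update h, l') \<in> triples (G f)"
      \<comment> \<open>The only edge at an assignment label is an update preserving
        \<open>vals P f\<close>, and \<open>t\<close> must be that edge.\<close>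
      have "h \<nu> \<in> vals P f"
        using a(1,2) by (cases rule: node_cases) (use l t a(3) in \<open>auto simp: out_edges_iff\<close>)
      then have "(f, l', h \<nu>) \<in> stack_elems P G" using se[OF t] by (auto simp: stack_elems_def)
      then show "?T (f, l', h \<nu>) + 1 \<le> ?T (f, l, \<nu>)"
        using l t step.assign[of l G f h l' \<nu> "[]"] by (intro step) auto
    next
      fix f' h l' assume l: "l \<in> Lc (G f) - {lout (G f)} \<and> \<nu> \<in> reach_vals P G fstar \<phi>star f l"
        and t: "(l, Enter f' h, l') \<in> triples (G f)"
      have f': "f' \<in> fnames P \<and> h \<nu> \<in> vals P f'"
        using a(1,2) by (cases rule: node_cases) (use l t in \<open>auto simp: out_edges_iff\<close>)
      then have "(f', lin (G f'), h \<nu>) \<in> stack_elems P G"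
        using cfg_okD(8)[OF graph_ok] by (auto simp: stack_elems_def)
      then show "1 + ?T (f', lin (G f'), h \<nu>) + ?T (f, l', \<nu>) \<le> ?T (f, l, \<nu>)"
        unfolding plus2 using l nt step.call[of l G f f' h l' \<nu> "[]"] t
        by (intro worst_time_call[OF c _ _ se[OF t]]) auto
    next
      fix \<phi> l1 l2 assume l: "l \<in> Lb (G f) - {lout (G f)} \<and> \<nu> \<in> reach_vals P G fstar \<phi>star f l"
        and t: "(l, Guard \<phi>, l1) \<in> triples (G f) \<and> (l, Guard (Neg \<phi>), l2) \<in> triples (G f)"
      show "of_bool (\<nu> \<Turnstile> \<phi>) * ?T (f, l1, \<nu>) + of_bool (\<nu> \<Turnstile> Neg \<phi>) * ?T (f, l2, \<nu>) + 1 \<le> ?T (f, l, \<nu>)"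
      proof (cases "\<nu> \<Turnstile> \<phi>")
        case True
        then have "?T (f, l1, \<nu>) + 1 \<le> ?T (f, l, \<nu>)"
          using l t step.branch_true[of l G f \<phi> l1 l2 \<nu> "[]"] se by (intro step) auto
        then show ?thesis using True by simp
      next
        case False
        then have "?T (f, l2, \<nu>) + 1 \<le> ?T (f, l, \<nu>)"
          using l t step.branch_false[of l G f \<phi> l1 l2 \<nu> "[]"] se by (intro step) auto
        then show ?thesis using False by simp
      qed
    next
      fix l1 l2 assume l: "l \<in> Ld (G f) - {lout (G f)} \<and> \<nu> \<in> reach_vals P G fstar \<phi>star f l"
        and t: "{(l, Star, l1), (l, Star, l2)} = {t \<in> triples (G f). fst t = l}"
      \<comment> \<open>The maximum is one of the two values, so each target is bounded
        separately.\<close>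
      have "?T (f, l', \<nu>) + 1 \<le> ?T (f, l, \<nu>)" if "l' \<in> {l1, l2}" for l'
      proof -
        have "(l, Star, l') \<in> triples (G f)" using t that by auto
        then show ?thesis
          using l step.demonic[of l G f l' \<nu> "[]"] se by (intro step) auto
      qed
      then show "max (?T (f, l1, \<nu>)) (?T (f, l2, \<nu>)) + 1 \<le> ?T (f, l, \<nu>)"
        by (simp add: max_def)
    qed
  qed
qed

section \<open>Soundness: the sum of a measure function over the stack\<close>

lemma measure_decreases:
  assumes g: "measure_function P G fstar \<phi>star g" and w: "w \<in> configs P G"
    and r: "reachable_config P G fstar \<phi>star w" and s: "live_step G w w'"
  shows "sum_list (map g w') + 1 \<le> sum_list (map g w)"
proof -
  obtain f l \<nu> v where weq: "w = (f, l, \<nu>) # v" using s unfolding live_step_def by (metis neq_Nil_conv prod_cases3)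
  have c: "f \<in> fnames P" "l \<in> labels (G f)" "\<nu> \<in> vals P f" "l \<noteq> lout (G f)"
    using w weq by (auto simp: configs_Cons)
  \<comment> \<open>C2 to C5 constrain \<open>g\<close> only at reachable letters; reachability of
    the configuration passes to its top letter.\<close>
  have D: "\<nu> \<in> reach_vals P G fstar \<phi>star f l"
    using r weq c unfolding reach_vals_def reachable_def by auto
  have "(f, l, \<nu>) \<in> stack_elems P G" using c by (simp add: stack_elems_def)
  \<comment> \<open>\<open>M\<close> collects C2 to C5 at the top letter; the facts that follow are
    its parts with reachability discharged.\<close>
  note M = bspec[OF g[unfolded measure_function_def] this, unfolded prod.case, THEN conjunct2]
  note C2 = M[THEN conjunct1, rule_format, OF conjI, OF DiffI D]
    and C3 = M[THEN conjunct2, THEN conjunct1, rule_format, OF conjI, OF DiffI D]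
    and C4 = M[THEN conjunct2, THEN conjunct2, THEN conjunct1, rule_format, OF conjI, OF DiffI D]
    and C5 = M[THEN conjunct2, THEN conjunct2, THEN conjunct2, rule_format, OF conjI, OF DiffI D]
  \<comment> \<open>\<open>u\<close> consists of the letters replacing the top before pruning; in
    this form the left-hand sides of C2 to C5 appear directly.\<close>
  have "\<exists>u. w' = prune G u @ v \<and> sum_list (map g u) + 1 \<le> g (f, l, \<nu>)"
  proof (rule step_cases[of f l \<nu> v w'])
    show "step G ((f, l, \<nu>) # v) w'" "(f, l, \<nu>) # v \<in> configs P G" using s w weq by (auto simp: live_step_def)
  next
    fix h l' assume "l \<in> La (G f)" "out_edges (G f) l = {(Update h, l')}"
      "w' = prune G [(f, l', h \<nu>)] @ v"
    moreover from this have "g (f, l', h \<nu>) + 1 \<le> g (f, l, \<nu>)"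
      using c(4) by (intro C2) (simp_all add: out_edges_iff)
    ultimately show ?thesis by (intro exI[of _ "[(f, l', h \<nu>)]"]) auto
  next
    fix f' h l' assume "l \<in> Lc (G f)" "out_edges (G f) l = {(Enter f' h, l')}"
      "w' = prune G [(f', lin (G f'), h \<nu>), (f, l', \<nu>)] @ v"
    moreover from this have "1 + g (f', lin (G f'), h \<nu>) + g (f, l', \<nu>) \<le> g (f, l, \<nu>)"
      using c(4) by (intro C3) (simp_all add: out_edges_iff)
    ultimately show ?thesis
      by (intro exI[of _ "[(f', lin (G f'), h \<nu>), (f, l', \<nu>)]"]) (auto simp: ac_simps)
  next
    fix \<phi> l1 l2 assume e: "l \<in> Lb (G f)"
      "out_edges (G f) l = {(Guard \<phi>, l1), (Guard (Neg \<phi>), l2)}"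
      "w' = prune G [(f, if \<nu> \<Turnstile> \<phi> then l1 else l2, \<nu>)] @ v"
    have t: "(l, Guard \<phi>, l1) \<in> triples (G f) \<and> (l, Guard (Neg \<phi>), l2) \<in> triples (G f)"
      using e(2) out_edges_iff[of l _ _ f] by auto
    have "of_bool (\<nu> \<Turnstile> \<phi>) * g (f, l1, \<nu>) + of_bool (\<nu> \<Turnstile> Neg \<phi>) * g (f, l2, \<nu>) + 1 \<le> g (f, l, \<nu>)"
      using c(4) e(1) t by (intro C4) simp_all
    \<comment> \<open>The branch not taken is multiplied by \<open>0\<close>, which removes it even
      if its value is infinite.\<close>
    then show ?thesis
      using e(3) by (intro exI[of _ "[(f, if \<nu> \<Turnstile> \<phi> then l1 else l2, \<nu>)]"]) (auto split: if_splits)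
  next
    fix l1 l2 assume e: "l \<in> Ld (G f)" "out_edges (G f) l = {(Star, l1), (Star, l2)}"
      "w' = prune G [(f, l1, \<nu>)] @ v \<or> w' = prune G [(f, l2, \<nu>)] @ v"
    \<comment> \<open>The premise of C5 asks for the full set of triples with source
      \<open>l\<close>, not just for two members.\<close>
    have t: "{(l, Star, l1), (l, Star, l2)} = {t \<in> triples (G f). fst t = l}"
      unfolding triples_from by (simp add: e(2))
    have "max (g (f, l1, \<nu>)) (g (f, l2, \<nu>)) + 1 \<le> g (f, l, \<nu>)"
      using c(4) e(1) t by (intro C5) simp_all
    moreover have "g (f, l', \<nu>) + 1 \<le> max (g (f, l1, \<nu>)) (g (f, l2, \<nu>)) + 1" if "l' \<in> {l1, l2}" for l'
      using that by (intro add_right_mono) auto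
    ultimately have "g (f, l', \<nu>) + 1 \<le> g (f, l, \<nu>)" if "l' \<in> {l1, l2}" for l'
      using that order_trans by blast
    then have "sum_list (map g [(f, l', \<nu>)]) + 1 \<le> g (f, l, \<nu>)" if "l' \<in> {l1, l2}" for l'
      using that by simp
    then show ?thesis using e(3) by blast
  qed
  then obtain u where u: "w' = prune G u @ v" "sum_list (map g u) + 1 \<le> g (f, l, \<nu>)" by blast
  have "sum_list (map g w') + 1 = (sum_list (map g (prune G u)) + 1) + sum_list (map g v)"
    using u(1) by (simp add: ac_simps)
  also have "\<dots> \<le> (sum_list (map g u) + 1) + sum_list (map g v)"
    by (intro add_right_mono sum_list_prune)
  also have "\<dots> \<le> g (f, l, \<nu>) + sum_list (map g v)"
    using u(2) by (rule add_right_mono)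
  finally show ?thesis using weq by simp
qed

text \<open>Each step of a run is paid for out of the initial value: after \<open>j\<close> steps
  the sum over the stack plus \<open>j\<close> is still at most \<open>g\<close> at the
  start.\<close>

lemma measure_bounds_worst_time:
  assumes g: "measure_function P G fstar \<phi>star g" and f: "fstar \<in> fnames P"
    and \<nu>: "\<nu> \<in> vals P fstar" "\<nu> \<Turnstile> \<phi>star"
  shows "ennreal_of_enat (worst_time P G (fstar, lin (G fstar), \<nu>)) \<le> g (fstar, lin (G fstar), \<nu>)"
proof (rule ennreal_of_enat_leI)
  let ?c = "(fstar, lin (G fstar), \<nu>)"
  note D = cfg_okD(8,9)[OF graph_ok[OF f]]
  have c: "?c \<in> stack_elems P G" and p: "prune G [?c] = [?c]"
    using f \<nu> D by (auto simp: stack_elems_def prune_def non_terminal_def)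
  fix n assume "enat n \<le> worst_time P G ?c"
  then obtain w where "(live_step G ^^ n) (prune G [?c]) w" using worst_time_ge[OF c] by blast
  \<comment> \<open>Reachability is defined through runs and \<open>measure_decreases\<close> asks
    for it at each step, so the path is traded for a run of some scheduler.\<close>
  then obtain \<pi> where \<pi>: "scheduler P G \<pi>" and live: "\<forall>j<n. run G ?c \<pi> j \<noteq> []"
    using path_scheduler[OF c] by blast
  have "j \<le> n \<Longrightarrow> sum_list (map g (run G ?c \<pi> j)) + of_nat j \<le> g ?c" for j
  proof (induction j)
    case 0
    then show ?case using p by (simp add: run_def)
  next
    case (Suc j)
    have "reachable_config P G fstar \<phi>star (run G ?c \<pi> j)"
      using \<pi> \<nu> unfolding reachable_config_def by blast
    then have "sum_list (map g (run G ?c \<pi> (Suc j))) + 1 \<le> sum_list (map g (run G ?c \<pi> j))"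
      using live Suc.prems run_step[OF \<pi> c] run_configs[OF \<pi> c] by (intro measure_decreases[OF g]) (auto simp: live_step_def)
    then have "sum_list (map g (run G ?c \<pi> (Suc j))) + 1 + of_nat j
        \<le> sum_list (map g (run G ?c \<pi> j)) + of_nat j"
      by (rule add_right_mono)
    also have "\<dots> \<le> g ?c" using Suc by simp
    finally show ?case by (simp add: ac_simps)
  qed
  from this[of n] show "of_nat n \<le> g ?c"
    by (auto intro: order_trans[rotated] add_increasing)
qed

end

theorem theorem1:
  fixes P :: "('f, 'v) program"
    and G :: "'f \<Rightarrow> ('l, 'f, 'v) cfg"
    and fstar :: 'f
    and \<phi>star :: "'v pred"
  assumes "wf_program P"
    and "program_cfg P G"
    and "fstar \<in> fnames P"
    and "wf_pred \<phi>star"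
    and "pred_vars \<phi>star \<subseteq> fvars P fstar"
  shows "(\<forall>g. measure_function P G fstar \<phi>star g \<longrightarrow>
            (\<forall>\<nu>\<in>vals P fstar. \<nu> \<Turnstile> \<phi>star \<longrightarrow>
               ennreal_of_enat (worst_time P G (fstar, lin (G fstar), \<nu>))
                 \<le> g (fstar, lin (G fstar), \<nu>)))
       \<and> measure_function P G fstar \<phi>star (\<lambda>c. ennreal_of_enat (worst_time P G c))"
proof -
  interpret program_graph P G by standard (fact assms)+
  show ?thesis using measure_bounds_worst_time assms(3) measure_worst_time by blast
qed

end
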